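(* Fix $\eta>0$ and $\varepsilon\in(0,1)$, and let $E\subset\mathbb{R}^N$ be a finite set of cardinality $|E|=p$. Let $k\ge 40\log\frac{4p}{\eta}$, and suppose that $\Phi\in\mathbb{R}^{m\times N}$ satisfies the Restricted Isometry Property of order $k$ and level $\delta\le\frac{\varepsilon}{4}$. Let $\xi\in\mathbb{R}^N$ be a Rademacher sequence, i.e. a random vector uniformly distributed on $\{-1,1\}^N$. Then with probability exceeding $1-\eta$, $$(1-\varepsilon)\|x\|_2^2\le\|\Phi D_\xi x\|_2^2\le(1+\varepsilon)\|x\|_2^2$$ holds uniformly for all $x\in E$.
   Context: A vector $x\in\mathbb{R}^N$ is $k$-sparse if $|\{j: |x_j|>0\}|\le k$. A matrix $\Phi\in\mathbb{R}^{m\times N}$ has the Restricted Isometry Property (RIP) of order $k$ and level $\delta\in(0,1)$ if $(1-\delta)\|x\|_2^2\le\|\Phi x\|_2^2\le(1+\delta)\|x\|_2^2$ for all $k$-sparse $x\in\mathbb{R}^N$. Here $k$ is a positive integer, $\log$ is the natural logarithm and $\|\cdot\|_2$ is the Euclidean norm. For a vector $\xi\in\mathbb{R}^N$, $D_\xi\in\mathbb{R}^{N\times N}$ denotes the diagonal matrix with $(D_\xi)_{j,j}=\xi_j$. *)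

theory Defs
  imports "HOL-Probability.Probability"
begin

definition sparse :: "nat \<Rightarrow> real ^ 'n \<Rightarrow> bool" where
  "sparse k x \<longleftrightarrow> card {j. \<bar>x $ j\<bar> > 0} \<le> k"

text \<open>The side conditions that the order is positive and the level lies in $(0,1)$ are not
  part of this predicate.\<close>

definition restricted_isometry :: "real ^ 'n ^ 'm \<Rightarrow> nat \<Rightarrow> real \<Rightarrow> bool" where
  "restricted_isometry \<Phi> k \<delta> \<longleftrightarrow>
     (\<forall>x. sparse k x \<longrightarrow>
        (1 - \<delta>) * (norm x)\<^sup>2 \<le> (norm (\<Phi> *v x))\<^sup>2 \<and>
        (norm (\<Phi> *v x))\<^sup>2 \<le> (1 + \<delta>) * (norm x)\<^sup>2)"

definition diag_mat :: "real ^ 'n \<Rightarrow> real ^ 'n ^ 'n" where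
  "diag_mat \<xi> = (\<chi> i j. if i = j then \<xi> $ i else 0)"

definition sign_vectors :: "(real ^ 'n) set" where
  "sign_vectors = {v. \<forall>j. v $ j \<in> {-1, 1}}"

text \<open>The uniform distribution on the finite set of sign vectors lives on the power set
  \<open>\<sigma>\<close>-algebra of that set; it is pushed forward along the inclusion so as to be
  comparable with the law of \<open>\<xi>\<close>, a Borel measure on the whole space.\<close>

definition rademacher_sequence :: "'a measure \<Rightarrow> ('a \<Rightarrow> real ^ 'n) \<Rightarrow> bool" where
  "rademacher_sequence M \<xi> \<longleftrightarrow>
     \<xi> \<in> borel_measurable M \<and>
     distr M borel \<xi> = distr (uniform_count_measure sign_vectors) borel (\<lambda>v. v)"

end

theory Submission
  imports Defs
begin

text \<open>
  For a unit vector \<open>x\<close>, cut the coordinates into blocks of size \<open>s = k div 2\<close> in decreasing order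
  of \<open>\<bar>x $ i\<bar>\<close> and expand \<open>\<parallel>\<Phi> D x\<parallel>\<^sup>2\<close> over pairs of blocks. The diagonal pairs contribute
  \<open>1\<close> up to \<open>\<delta>\<close>, whatever the signs are. The restricted isometry property makes images of distinct
  blocks almost orthogonal, and every entry of a block is at most \<open>1 / sqrt s\<close> times the norm of the
  previous block. Hence the pairs involving the first block form, given the signs there, a Rademacher
  sum with coefficient vector of norm at most \<open>\<delta> / sqrt s\<close>, and the remaining pairs form a Rademacher
  chaos whose matrix has operator norm at most \<open>\<delta> / s\<close> and Frobenius norm at most \<open>\<delta> / sqrt s\<close>.

  The exponential moments of the chaos are bounded by decoupling twice: first the form of \<open>C\<close> is
  reduced to \<open>\<parallel>C v\<parallel>\<^sup>2\<close>, and then the form of \<open>C\<^sup>T C\<close> is reduced to a small multiple of \<open>\<parallel>C v\<parallel>\<^sup>2\<close> itself.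
  Markov's inequality for the exponential moment then gives failure probability at most
  \<open>2 * exp (- s / 15)\<close> for each \<open>x\<close>, and a union bound over \<open>E\<close> finishes the proof.
\<close>

subsection \<open>Averages over sign vectors\<close>

text \<open>The expectation over a uniform sign vector, kept as a finite sum so that interchanging
  means needs no integrability. \<open>measure_rademacher_sequence\<close> connects it to the given
  probability space.\<close>

definition rad_mean :: "(real ^ 'n \<Rightarrow> real) \<Rightarrow> real" where
  "rad_mean f = (\<Sum>v\<in>sign_vectors. f v) / real (card (sign_vectors :: (real ^ 'n) set))"

lemma sign_vectors_eq: "(sign_vectors :: (real ^ 'n) set) = vec_lambda ` (PiE UNIV (\<lambda>_. {-1, 1}))"
proof
  show "(sign_vectors :: (real ^ 'n) set) \<subseteq> vec_lambda ` (PiE UNIV (\<lambda>_. {-1, 1}))"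
  proof
    fix v :: "real ^ 'n" assume "v \<in> sign_vectors"
    then have "vec_nth v \<in> PiE UNIV (\<lambda>_. {-1, 1})" by (auto simp: sign_vectors_def PiE_def Pi_def)
    moreover have "v = vec_lambda (vec_nth v)" by simp
    ultimately show "v \<in> vec_lambda ` (PiE UNIV (\<lambda>_. {-1, 1}))" by blast
  qed
qed (auto simp: sign_vectors_def PiE_def Pi_def)

lemma finite_sign_vectors [simp]: "finite (sign_vectors :: (real ^ 'n) set)"
  unfolding sign_vectors_eq by (intro finite_imageI finite_PiE) auto

lemma one_in_sign_vectors: "1 \<in> sign_vectors"
  by (simp add: sign_vectors_def)

lemma card_sign_vectors_pos [simp]: "0 < card (sign_vectors :: (real ^ 'n) set)"
  using one_in_sign_vectors by (subst card_gt_0_iff) auto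

lemma sign_vectors_nonempty [simp]: "(sign_vectors :: (real ^ 'n) set) \<noteq> {}"
  using one_in_sign_vectors by auto

lemma sign_vectors_sq: "v \<in> sign_vectors \<Longrightarrow> v $ i * v $ i = 1"
  by (auto simp: sign_vectors_def dest: spec[of _ i])

lemma sign_vectors_mult: "v \<in> sign_vectors \<Longrightarrow> w \<in> sign_vectors \<Longrightarrow> v * w \<in> sign_vectors"
proof -
  assume v: "v \<in> sign_vectors" and w: "w \<in> sign_vectors"
  have "(v * w) $ j \<in> {-1, 1}" for j
  proof -
    have "v $ j \<in> {-1, 1}" "w $ j \<in> {-1, 1}" using v w by (auto simp: sign_vectors_def)
    then show ?thesis by auto
  qed
  then show ?thesis by (simp add: sign_vectors_def)
qed

text \<open>Expanding the product of two-term sums picks a sign at each coordinate; this is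
  independence of the coordinates in finite form.\<close>

lemma sum_prod_sign_vectors:
  fixes g :: "'n::finite \<Rightarrow> real \<Rightarrow> real"
  shows "(\<Sum>v\<in>sign_vectors. \<Prod>i\<in>UNIV. g i (v $ i)) = (\<Prod>i\<in>UNIV. g i 1 + g i (-1))"
proof -
  have "(\<Prod>i\<in>(UNIV::'n set). g i 1 + g i (-1)) = (\<Prod>i\<in>UNIV. \<Sum>y\<in>{-1,1}. g i y)"
    by (simp add: add.commute)
  also have "\<dots> = (\<Sum>h\<in>PiE UNIV (\<lambda>_. {-1, 1}). \<Prod>i\<in>UNIV. g i (h i))"
    by (intro prod_sum_PiE) auto
  also have "\<dots> = (\<Sum>v\<in>sign_vectors. \<Prod>i\<in>UNIV. g i (v $ i))"
    unfolding sign_vectors_eq by (subst sum.reindex) (auto simp: inj_on_def vec_lambda_inject)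
  finally show ?thesis by simp
qed

lemma card_sign_vectors: "card (sign_vectors :: (real ^ 'n) set) = 2 ^ CARD('n)"
proof -
  have "real (card (sign_vectors :: (real ^ 'n) set)) = real (2 ^ CARD('n))"
    using sum_prod_sign_vectors[of "\<lambda>(_::'n) _. 1"] by simp
  then show ?thesis unfolding of_nat_eq_iff .
qed

lemma rad_mean_mono:
  "(\<And>v. v \<in> sign_vectors \<Longrightarrow> f v \<le> g v) \<Longrightarrow> rad_mean f \<le> rad_mean g"
  unfolding rad_mean_def by (intro divide_right_mono sum_mono) auto

lemma rad_mean_cong:
  "(\<And>v. v \<in> sign_vectors \<Longrightarrow> f v = g v) \<Longrightarrow> rad_mean f = rad_mean g"
  unfolding rad_mean_def by (intro arg_cong2[where f = "(/)"] sum.cong) auto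

lemma rad_mean_const [simp]: "rad_mean (\<lambda>_. c) = c"
  by (simp add: rad_mean_def)

lemma rad_mean_add: "rad_mean (\<lambda>v. f v + g v) = rad_mean f + rad_mean g"
  by (simp add: rad_mean_def sum.distrib add_divide_distrib)

lemma rad_mean_cmult: "rad_mean (\<lambda>v. c * f v) = c * rad_mean f"
  by (simp add: rad_mean_def sum_distrib_left)

lemma rad_mean_sum: "rad_mean (\<lambda>v. \<Sum>i\<in>I. f i v) = (\<Sum>i\<in>I. rad_mean (f i))"
  unfolding rad_mean_def by (subst sum.swap) (simp add: sum_divide_distrib)

lemma rad_mean_swap:
  "rad_mean (\<lambda>v. rad_mean (\<lambda>w. f v w)) = rad_mean (\<lambda>w. rad_mean (\<lambda>v. f v w))"
  unfolding rad_mean_def sum_divide_distrib[symmetric] by (subst sum.swap) simp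

lemma rad_mean_nonneg: "(\<And>v. v \<in> sign_vectors \<Longrightarrow> 0 \<le> f v) \<Longrightarrow> 0 \<le> rad_mean f"
  unfolding rad_mean_def by (intro divide_nonneg_nonneg sum_nonneg) auto

text \<open>Multiplication by \<open>w\<close> is an involution of the sign vectors. This invariance
  later allows some of the signs to be resampled while the others stay fixed.\<close>

lemma rad_mean_mult_sign:
  assumes "w \<in> sign_vectors"
  shows "rad_mean (\<lambda>v. f (w * v)) = rad_mean f"
proof -
  have ww: "w * (w * v) = v" for v
    using sign_vectors_sq[OF assms] by (auto simp: vec_eq_iff mult.assoc[symmetric])
  have "(\<Sum>v\<in>sign_vectors. f (w * v)) = (\<Sum>v\<in>sign_vectors. f v)"
    by (rule sum.reindex_bij_witness[where i = "(*) w" and j = "(*) w"])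
       (auto simp: ww sign_vectors_mult assms)
  then show ?thesis by (simp add: rad_mean_def)
qed

lemma rad_mean_component: "rad_mean (\<lambda>v. v $ i) = 0"
proof -
  have "rad_mean (\<lambda>v. v $ i) = rad_mean (\<lambda>v. ((-1) * v) $ i)"
    by (rule rad_mean_mult_sign[symmetric]) (simp add: sign_vectors_def)
  also have "\<dots> = - rad_mean (\<lambda>v. v $ i)"
    using rad_mean_cmult[of "-1" "\<lambda>v. v $ i"] by simp
  finally show ?thesis by simp
qed

lemma rad_mean_component_mult:
  "rad_mean (\<lambda>v. v $ i * v $ j) = (if i = j then 1 else 0)"
proof (cases "i = j")
  case True
  then show ?thesis using rad_mean_cong[of "\<lambda>v. v $ i * v $ j" "\<lambda>_. 1"] by (simp add: sign_vectors_sq)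
next
  case False
  \<comment> \<open>Flipping only the sign at \<open>i\<close> negates the product, so its mean
    equals its own negative.\<close>
  define w :: "real ^ 'a" where "w = (\<chi> l. if l = i then -1 else 1)"
  have "rad_mean (\<lambda>v. v $ i * v $ j) = rad_mean (\<lambda>v. (w * v) $ i * (w * v) $ j)"
    by (rule rad_mean_mult_sign[symmetric]) (simp add: sign_vectors_def w_def)
  also have "\<dots> = - rad_mean (\<lambda>v. v $ i * v $ j)"
    using False rad_mean_cmult[of "-1" "\<lambda>v. v $ i * v $ j"] by (simp add: w_def)
  finally show ?thesis using False by simp
qed

subsection \<open>Exponential moments of Rademacher sums and chaoses\<close>

lemma cosh_le_exp_half_sq: "cosh (x::real) \<le> exp (x\<^sup>2 / 2)"
proof -
  have pos: "cosh x \<le> exp (x\<^sup>2 / 2)" if x: "0 \<le> x" for x :: real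
  proof -
    \<comment> \<open>The difference \<open>t * cosh t - sinh t\<close> has derivative
      \<open>t * sinh t\<close>, which is nonnegative here; this makes
      \<open>exp (- t\<^sup>2 / 2) * cosh t\<close> nonincreasing.\<close>
    have tanh: "sinh t \<le> t * cosh t" if "0 \<le> t" for t :: real
    proof -
      have "0 * cosh 0 - sinh 0 \<le> t * cosh t - sinh t"
        by (rule DERIV_nonneg_imp_nondecreasing[OF that])
           (auto intro!: exI derivative_eq_intros mult_nonneg_nonneg)
      then show ?thesis by simp
    qed
    have "exp (- x\<^sup>2 / 2) * cosh x \<le> exp (- 0\<^sup>2 / 2) * cosh 0"
    proof (rule DERIV_nonpos_imp_nonincreasing[OF x])
      fix t :: real assume "0 \<le> t" "t \<le> x"
      have "((\<lambda>t. exp (- t\<^sup>2 / 2) * cosh t) has_real_derivative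
             exp (- t\<^sup>2 / 2) * (sinh t - t * cosh t)) (at t)"
        by (auto intro!: derivative_eq_intros simp: algebra_simps)
      moreover have "exp (- t\<^sup>2 / 2) * (sinh t - t * cosh t) \<le> 0"
        using tanh[OF \<open>0 \<le> t\<close>] by (simp add: mult_le_0_iff)
      ultimately show "\<exists>y. ((\<lambda>t. exp (- t\<^sup>2 / 2) * cosh t) has_real_derivative y) (at t) \<and> y \<le> 0"
        by blast
    qed
    then have "exp (- (x\<^sup>2 / 2)) * cosh x \<le> 1" by simp
    then show ?thesis by (simp add: exp_minus divide_simps)
  qed
  show ?thesis using pos[of x] pos[of "-x"] by (cases "0 \<le> x") auto
qed

text \<open>By independence the mean is the product of the factors \<open>cosh (w $ i)\<close>, and
  each of these has a Gaussian bound.\<close>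

lemma rad_mean_exp_inner_le: "rad_mean (\<lambda>v. exp (v \<bullet> w)) \<le> exp ((norm w)\<^sup>2 / 2)"
proof -
  have "rad_mean (\<lambda>v. exp (v \<bullet> w)) = (\<Sum>v\<in>sign_vectors. \<Prod>i\<in>UNIV. exp (v $ i * w $ i)) / 2 ^ CARD('a)"
    by (simp add: rad_mean_def inner_vec_def exp_sum card_sign_vectors)
  also have "\<dots> = (\<Prod>i\<in>UNIV. cosh (w $ i))"
    by (subst sum_prod_sign_vectors[of "\<lambda>i y. exp (y * w $ i)"])
       (simp add: cosh_def prod_dividef)
  also have "\<dots> \<le> (\<Prod>i\<in>UNIV. exp ((w $ i)\<^sup>2 / 2))"
    by (intro prod_mono) (auto simp: cosh_le_exp_half_sq)
  also have "\<dots> = exp ((norm w)\<^sup>2 / 2)"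
    unfolding power2_norm_eq_inner inner_vec_def
    by (simp add: exp_sum[symmetric] power2_eq_square sum_divide_distrib)
  finally show ?thesis .
qed

section \<open>Convexity of the exponential\<close>

lemma exp_rad_mean_le: "exp (rad_mean f) \<le> rad_mean (\<lambda>v. exp (f v))"
proof -
  \<comment> \<open>Jensen's inequality via the tangent of \<open>exp\<close> at the mean, whose
    average is exactly \<open>exp (rad_mean f)\<close>.\<close>
  have "exp (rad_mean f) = rad_mean (\<lambda>v. exp (rad_mean f) * ((1 - rad_mean f) + f v))"
    by (simp add: rad_mean_cmult rad_mean_add)
  also have "\<dots> \<le> rad_mean (\<lambda>v. exp (f v))"
  proof (rule rad_mean_mono)
    fix v
    have "exp (rad_mean f) * (1 + (f v - rad_mean f)) \<le> exp (rad_mean f) * exp (f v - rad_mean f)"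
      by (intro mult_left_mono exp_ge_add_one_self) auto
    then show "exp (rad_mean f) * ((1 - rad_mean f) + f v) \<le> exp (f v)"
      by (simp add: exp_diff algebra_simps)
  qed
  finally show ?thesis .
qed

lemma exp_mult_le: "0 \<le> r \<Longrightarrow> r \<le> 1 \<Longrightarrow> exp (r * y) \<le> 1 - r + r * exp (y::real)"
  using convex_onD[OF exp_convex, of r 0 y] by (simp add: algebra_simps)

lemma exp_midpoint_le: "exp ((a + b) / 2) \<le> (exp a + exp b) / (2::real)"
proof -
  have "0 \<le> (exp (a/2) - exp (b/2))\<^sup>2" by simp
  also have "\<dots> = exp a + exp b - 2 * exp ((a + b) / 2)"
    by (simp add: power2_eq_square algebra_simps exp_add[symmetric] add_divide_distrib)
  finally show ?thesis by simp
qed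

lemma rad_mean_exp_pos: "0 < rad_mean (\<lambda>v. exp (f v))"
  using exp_rad_mean_le[of f] exp_gt_zero by (rule less_le_trans[rotated])

text \<open>Jensen's inequality for the concave power \<open>r\<close>. Subtracting the logarithm
  \<open>L\<close> of the mean normalises the mean of \<open>exp (f v - L)\<close> to 1, and the
  chord bound \<open>exp_mult_le\<close> then averages to 1.\<close>

lemma rad_mean_exp_mult_le:
  assumes "0 \<le> r" "r \<le> 1"
  shows "rad_mean (\<lambda>v. exp (r * f v)) \<le> exp (r * ln (rad_mean (\<lambda>v. exp (f v))))"
proof -
  define L where "L = ln (rad_mean (\<lambda>v. exp (f v)))"
  have L: "exp L = rad_mean (\<lambda>v. exp (f v))" unfolding L_def using rad_mean_exp_pos by simp
  have "rad_mean (\<lambda>v. exp (r * f v)) \<le> rad_mean (\<lambda>v. exp (r * L) * ((1 - r) + (r * exp (-L)) * exp (f v)))"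
  proof (rule rad_mean_mono)
    fix v
    have "exp (r * f v) = exp (r * L) * exp (r * (f v - L))"
      by (simp add: exp_add[symmetric] algebra_simps)
    also have "\<dots> \<le> exp (r * L) * (1 - r + r * exp (f v - L))"
      by (intro mult_left_mono exp_mult_le assms) auto
    finally show "exp (r * f v) \<le> exp (r * L) * ((1 - r) + (r * exp (-L)) * exp (f v))"
      by (simp add: exp_diff exp_minus field_simps)
  qed
  also have "\<dots> = exp (r * L) * ((1 - r) + (r * exp (-L)) * exp L)"
    unfolding rad_mean_cmult rad_mean_add rad_mean_const L by simp
  also have "\<dots> = exp (r * L)" by (simp add: exp_minus)
  finally show ?thesis by (simp add: L_def)
qed

text \<open>The signs \<open>t\<close> select a random set of coordinates \<open>{i. t $ i = 1}\<close>; on average the bilinear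
  form between this set and its complement is a quarter of the off-diagonal part of \<open>C\<close>.\<close>

lemma rad_mean_decoupled:
  fixes C :: "real ^ 'n ^ 'n"
  assumes v: "v \<in> sign_vectors"
  shows "rad_mean (\<lambda>t. ((1 + t) * v) \<bullet> (C *v ((1 - t) * v))) = v \<bullet> (C *v v) - trace C"
proof -
  have m: "rad_mean (\<lambda>t. (1 + t $ i) * (1 - t $ j)) = 1 - (if i = j then 1 else 0)" for i j :: 'n
  proof -
    have "rad_mean (\<lambda>t. (1 + t $ i) * (1 - t $ j))
        = rad_mean (\<lambda>t. 1 + (t $ i + ((-1) * t $ j + (-1) * (t $ i * t $ j))))"
      by (simp add: algebra_simps)
    also have "\<dots> = 1 - (if i = j then 1 else 0)"
      unfolding rad_mean_add rad_mean_cmult by (simp add: rad_mean_component rad_mean_component_mult)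
    finally show ?thesis .
  qed
  have "rad_mean (\<lambda>t. ((1 + t) * v) \<bullet> (C *v ((1 - t) * v)))
      = rad_mean (\<lambda>t. \<Sum>i\<in>UNIV. \<Sum>j\<in>UNIV. (v $ i * C $ i $ j * v $ j) * ((1 + t $ i) * (1 - t $ j)))"
    by (simp add: inner_vec_def matrix_vector_mult_def sum_distrib_left mult_ac)
  also have "\<dots> = (\<Sum>i\<in>UNIV. \<Sum>j\<in>UNIV. (v $ i * C $ i $ j * v $ j) * (1 - (if i = j then 1 else 0)))"
    unfolding rad_mean_sum rad_mean_cmult m ..
  also have "\<dots> = (\<Sum>i\<in>UNIV. (\<Sum>j\<in>UNIV. v $ i * C $ i $ j * v $ j) - v $ i * v $ i * C $ i $ i)"
    by (simp add: algebra_simps sum_subtractf if_distrib[of "\<lambda>x. _ * x"] if_distrib[of "\<lambda>x. x * _"] cong: if_cong)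
  also have "\<dots> = v \<bullet> (C *v v) - trace C"
    by (simp add: sum_subtractf sign_vectors_sq[OF v] trace_def inner_vec_def matrix_vector_mult_def
        sum_distrib_left mult_ac)
  finally show ?thesis .
qed

lemma rad_mean_exp_split_le:
  fixes C :: "real ^ 'n ^ 'n"
  assumes t: "t \<in> sign_vectors"
  shows "rad_mean (\<lambda>v. exp (c * (((1 + t) * v) \<bullet> (C *v ((1 - t) * v)))))
       \<le> rad_mean (\<lambda>v. exp (8 * c\<^sup>2 * (norm (C *v v))\<^sup>2))"
proof -
  \<comment> \<open>For fixed \<open>t\<close> the exponent is linear in the signs selected by \<open>t\<close>, so these can be resampled
    independently of the others, by \<open>fl e\<close>. Since \<open>t * v\<close> has the law of \<open>v\<close>, convexity then removes \<open>t\<close>.\<close>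
  define q where "q v = exp (c * (((1 + t) * v) \<bullet> (C *v ((1 - t) * v))))" for v
  define fl :: "real ^ 'n \<Rightarrow> real ^ 'n" where "fl e = (\<chi> i. if t $ i = 1 then e $ i else 1)" for e
  have t_cases: "t $ i = 1 \<or> t $ i = -1" for i using t by (auto simp: sign_vectors_def)
  have fl: "fl e \<in> sign_vectors" if "e \<in> sign_vectors" for e
    using that by (auto simp: sign_vectors_def fl_def)
  have q_fl: "q (fl e * v) = exp (e \<bullet> (c *\<^sub>R ((1 + t) * v * (C *v ((1 - t) * v)))))" for e v
  proof -
    have "(1 - t $ i) * fl e $ i = 1 - t $ i" "(1 + t $ i) * fl e $ i = (1 + t $ i) * e $ i" for i
      using t_cases[of i] by (auto simp: fl_def)
    then have "(1 - t) * (fl e * v) = (1 - t) * v" "(1 + t) * (fl e * v) = (1 + t) * (e * v)"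
      by (simp_all add: vec_eq_iff flip: mult.assoc)
    then show ?thesis
      by (simp add: q_def inner_vec_def sum_distrib_left mult_ac)
  qed
  \<comment> \<open>The entries of \<open>(1 + t) * v\<close> are 0 or 2 in absolute value, hence
    the factor 4.\<close>
  have norm_le: "(norm (c *\<^sub>R ((1 + t) * v * w)))\<^sup>2 \<le> 4 * c\<^sup>2 * (norm w)\<^sup>2" if "v \<in> sign_vectors" for v w
  proof -
    have "(c * ((1 + t $ i) * v $ i * w $ i))\<^sup>2 \<le> 4 * c\<^sup>2 * (w $ i)\<^sup>2" for i
    proof -
      have "((1 + t $ i) * v $ i)\<^sup>2 \<le> 4"
        using t_cases[of i] sign_vectors_sq[OF that, of i] by (auto simp: power_mult_distrib power2_eq_square)
      then have "((1 + t $ i) * v $ i)\<^sup>2 * (c\<^sup>2 * (w $ i)\<^sup>2) \<le> 4 * (c\<^sup>2 * (w $ i)\<^sup>2)"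
        by (intro mult_right_mono) auto
      then show ?thesis by (simp add: power_mult_distrib mult_ac)
    qed
    then have "(\<Sum>i\<in>UNIV. (c * ((1 + t $ i) * v $ i * w $ i))\<^sup>2) \<le> (\<Sum>i\<in>UNIV. 4 * c\<^sup>2 * (w $ i)\<^sup>2)"
      by (rule sum_mono)
    then show ?thesis
      unfolding power2_norm_eq_inner inner_vec_def
      by (simp add: sum_distrib_left power2_eq_square mult_ac)
  qed
  have "rad_mean q = rad_mean (\<lambda>e. rad_mean (\<lambda>v. q (fl e * v)))"
    using rad_mean_cong[of "\<lambda>e. rad_mean (\<lambda>v. q (fl e * v))" "\<lambda>_. rad_mean q"]
    by (simp add: rad_mean_mult_sign fl)
  also have "\<dots> = rad_mean (\<lambda>v. rad_mean (\<lambda>e. q (fl e * v)))" by (rule rad_mean_swap)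
  also have "\<dots> \<le> rad_mean (\<lambda>v. exp ((norm (c *\<^sub>R ((1 + t) * v * (C *v ((1 - t) * v)))))\<^sup>2 / 2))"
    unfolding q_fl by (intro rad_mean_mono rad_mean_exp_inner_le)
  also have "\<dots> \<le> rad_mean (\<lambda>v. (1/2) * (exp (8 * c\<^sup>2 * (norm (C *v v))\<^sup>2) + exp (8 * c\<^sup>2 * (norm (C *v (t * v)))\<^sup>2)))"
  proof (rule rad_mean_mono)
    fix v :: "real ^ 'n" assume v: "v \<in> sign_vectors"
    define a b where "a = C *v v" and "b = C *v (t * v)"
    \<comment> \<open>Since \<open>(1 - t) * v = v - t * v\<close>, the exponent is at most the
      midpoint of \<open>8 * c\<^sup>2 * (norm a)\<^sup>2\<close> and the same term in
      \<open>b\<close>: 4/2 comes from \<open>norm_le\<close>, 2 from squaring a difference, 2 from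
      the midpoint.\<close>
    have w: "C *v ((1 - t) * v) = a - b"
      by (simp add: a_def b_def algebra_simps)
    have "(norm (a - b))\<^sup>2 \<le> 2 * (norm a)\<^sup>2 + 2 * (norm b)\<^sup>2"
      using zero_le_power2[of "norm (a + b)"]
      by (simp add: power2_norm_eq_inner inner_diff_left inner_diff_right inner_add_left inner_add_right inner_commute)
    then have "2 * c\<^sup>2 * (norm (a - b))\<^sup>2 \<le> 2 * c\<^sup>2 * (2 * (norm a)\<^sup>2 + 2 * (norm b)\<^sup>2)"
      by (intro mult_left_mono) auto
    then have "(norm (c *\<^sub>R ((1 + t) * v * (a - b))))\<^sup>2 / 2 \<le> (8 * c\<^sup>2 * (norm a)\<^sup>2 + 8 * c\<^sup>2 * (norm b)\<^sup>2) / 2"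
      using norm_le[OF v, of "a - b"] by (simp add: algebra_simps)
    then have "exp ((norm (c *\<^sub>R ((1 + t) * v * (a - b))))\<^sup>2 / 2) \<le> (exp (8 * c\<^sup>2 * (norm a)\<^sup>2) + exp (8 * c\<^sup>2 * (norm b)\<^sup>2)) / 2"
      by (intro order_trans[OF _ exp_midpoint_le]) simp
    then show "exp ((norm (c *\<^sub>R ((1 + t) * v * (C *v ((1 - t) * v)))))\<^sup>2 / 2)
      \<le> (1/2) * (exp (8 * c\<^sup>2 * (norm (C *v v))\<^sup>2) + exp (8 * c\<^sup>2 * (norm (C *v (t * v)))\<^sup>2))"
      unfolding w by (simp add: a_def b_def)
  qed
  also have "\<dots> = rad_mean (\<lambda>v. exp (8 * c\<^sup>2 * (norm (C *v v))\<^sup>2))"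
    unfolding rad_mean_cmult rad_mean_add
    using rad_mean_mult_sign[OF t, of "\<lambda>v. exp (8 * c\<^sup>2 * (norm (C *v v))\<^sup>2)"] by simp
  finally show ?thesis by (simp add: q_def[abs_def])
qed

text \<open>The centred form is the mean over \<open>t\<close> of the decoupled forms. Jensen's
  inequality and an interchange of means reduce the claim to a fixed \<open>t\<close>, where the
  bound does not involve \<open>t\<close>.\<close>

lemma rad_mean_exp_chaos_le:
  fixes C :: "real ^ 'n ^ 'n"
  shows "rad_mean (\<lambda>v. exp (c * (v \<bullet> (C *v v) - trace C)))
       \<le> rad_mean (\<lambda>v. exp (8 * c\<^sup>2 * (norm (C *v v))\<^sup>2))"
proof -
  have "rad_mean (\<lambda>v. exp (c * (v \<bullet> (C *v v) - trace C)))
     \<le> rad_mean (\<lambda>v. rad_mean (\<lambda>t. exp (c * (((1 + t) * v) \<bullet> (C *v ((1 - t) * v))))))"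
    by (intro rad_mean_mono order_trans[OF _ exp_rad_mean_le])
       (simp add: rad_mean_cmult rad_mean_decoupled)
  also have "\<dots> = rad_mean (\<lambda>t. rad_mean (\<lambda>v. exp (c * (((1 + t) * v) \<bullet> (C *v ((1 - t) * v))))))"
    by (rule rad_mean_swap)
  also have "\<dots> \<le> rad_mean (\<lambda>t::real^'n. rad_mean (\<lambda>v. exp (8 * c\<^sup>2 * (norm (C *v v))\<^sup>2)))"
    by (intro rad_mean_mono rad_mean_exp_split_le)
  finally show ?thesis by simp
qed

text \<open>Serves to bound the norm of a vector after testing a bilinear form against the vector
  itself.\<close>

lemma le_if_sq_le_mult:
  fixes a :: real
  assumes "a * a \<le> c * a" "0 \<le> c"
  shows "a \<le> c"
proof (cases "a \<le> 0")
  case False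
  then show ?thesis using assms(1) by (intro mult_right_le_imp_le[of a a c]) auto
qed (use assms(2) in linarith)

lemma inner_transpose_mult:
  fixes A :: "real ^ 'n ^ 'm"
  shows "x \<bullet> (A *v y) = (transpose A *v x) \<bullet> y"
  using dot_lmul_matrix[of x A y] by simp

lemma norm_transpose_mult_le:
  fixes A :: "real ^ 'n ^ 'm"
  assumes "\<And>u. norm (A *v u) \<le> \<kappa> * norm u" "0 \<le> \<kappa>"
  shows "norm (transpose A *v x) \<le> \<kappa> * norm x"
proof -
  define y where "y = transpose A *v x"
  have "norm y * norm y = x \<bullet> (A *v y)"
    by (simp add: inner_transpose_mult y_def norm_eq_sqrt_inner)
  also have "\<dots> \<le> norm x * norm (A *v y)" by (rule norm_cauchy_schwarz)
  also have "\<dots> \<le> norm x * (\<kappa> * norm y)" by (intro mult_left_mono assms) auto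
  finally have "norm y * norm y \<le> (\<kappa> * norm x) * norm y" by (simp add: mult_ac)
  then have "norm y \<le> \<kappa> * norm x"
    using assms(2) by - (rule le_if_sq_le_mult, auto)
  then show ?thesis by (simp add: y_def)
qed

lemma rad_mean_exp_norm_sq_le:
  fixes C :: "real ^ 'n ^ 'm"
  assumes C: "\<And>u. norm (C *v u) \<le> \<kappa> * norm u" and "0 \<le> \<kappa>" "0 \<le> c" and r: "8 * c * \<kappa>\<^sup>2 < 1"
    and F: "(\<Sum>j\<in>UNIV. (norm (column j C))\<^sup>2) \<le> F"
  shows "rad_mean (\<lambda>v. exp (c * (norm (C *v v))\<^sup>2)) \<le> exp (c * F / (1 - 8 * c * \<kappa>\<^sup>2))"
proof -
  \<comment> \<open>Decoupling the form of \<open>C\<^sup>T C\<close> bounds the moment generating function of \<open>X\<close> by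
    that of \<open>r * X\<close> with \<open>r < 1\<close>, up to a factor coming from the trace; by Jensen's inequality this closes up.\<close>
  define A where "A = transpose C ** C"
  define r where "r = 8 * c * \<kappa>\<^sup>2"
  define X where "X v = c * (norm (C *v v))\<^sup>2" for v
  define L where "L = ln (rad_mean (\<lambda>v. exp (X v)))"
  have r01: "0 \<le> r" "r < 1" using assms by (auto simp: r_def)
  have inner: "v \<bullet> (A *v v) = (norm (C *v v))\<^sup>2" for v
    by (simp add: A_def matrix_vector_mul_assoc[symmetric] power2_norm_eq_inner dot_lmul_matrix inner_commute[of v])
  have tr: "trace A = (\<Sum>j\<in>UNIV. (norm (column j C))\<^sup>2)"
    by (simp add: A_def trace_def matrix_matrix_mult_def power2_norm_eq_inner inner_vec_def column_def transpose_def)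
  have A: "(norm (A *v v))\<^sup>2 \<le> \<kappa>\<^sup>2 * (norm (C *v v))\<^sup>2" for v
  proof -
    have "norm (A *v v) \<le> \<kappa> * norm (C *v v)"
      using norm_transpose_mult_le[OF C \<open>0 \<le> \<kappa>\<close>, of "C *v v"]
      by (simp add: A_def matrix_vector_mul_assoc[symmetric])
    then have "(norm (A *v v))\<^sup>2 \<le> (\<kappa> * norm (C *v v))\<^sup>2" by (intro power_mono) auto
    then show ?thesis by (simp add: power_mult_distrib)
  qed
  have "rad_mean (\<lambda>v. exp (X v)) = rad_mean (\<lambda>v. exp (c * trace A) * exp (c * (v \<bullet> (A *v v) - trace A)))"
    by (simp add: inner X_def exp_add[symmetric] algebra_simps)
  also have "\<dots> = exp (c * trace A) * rad_mean (\<lambda>v. exp (c * (v \<bullet> (A *v v) - trace A)))"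
    by (rule rad_mean_cmult)
  also have "\<dots> \<le> exp (c * F) * rad_mean (\<lambda>v. exp (8 * c\<^sup>2 * (norm (A *v v))\<^sup>2))"
    using F \<open>0 \<le> c\<close> by (intro mult_mono rad_mean_exp_chaos_le rad_mean_nonneg) (auto simp: tr mult_left_mono)
  also have "rad_mean (\<lambda>v. exp (8 * c\<^sup>2 * (norm (A *v v))\<^sup>2)) \<le> rad_mean (\<lambda>v. exp (r * X v))"
  proof (rule rad_mean_mono)
    fix v
    have "8 * c\<^sup>2 * (norm (A *v v))\<^sup>2 \<le> 8 * c\<^sup>2 * (\<kappa>\<^sup>2 * (norm (C *v v))\<^sup>2)"
      by (intro mult_left_mono A) auto
    then show "exp (8 * c\<^sup>2 * (norm (A *v v))\<^sup>2) \<le> exp (r * X v)"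
      by (simp add: r_def X_def power2_eq_square mult_ac)
  qed
  also have "rad_mean (\<lambda>v. exp (r * X v)) \<le> exp (r * L)"
    unfolding L_def using r01 by (intro rad_mean_exp_mult_le) auto
  finally have "rad_mean (\<lambda>v. exp (X v)) \<le> exp (c * F) * exp (r * L)" by simp
  then have "exp L \<le> exp (c * F + r * L)"
    by (simp add: L_def rad_mean_exp_pos exp_add)
  then have "L * (1 - r) \<le> c * F" by (simp add: algebra_simps)
  then have "L \<le> c * F / (1 - r)" using r01 by (simp add: pos_le_divide_eq)
  then have "exp L \<le> exp (c * F / (1 - r))" by simp
  then show ?thesis by (simp add: L_def rad_mean_exp_pos r_def X_def)
qed

text \<open>Both decouplings in succession: the first produces the parameter
  \<open>8 * c\<^sup>2\<close>, so the smallness condition of the second carries 8 * 8 = 64.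
  \<open>c\<close> may have either sign, as both tails are wanted.\<close>

lemma rad_mean_exp_chaos_tr0_le:
  fixes C :: "real ^ 'n ^ 'n"
  assumes C: "\<And>u. norm (C *v u) \<le> \<kappa> * norm u" and "0 \<le> \<kappa>" and r: "64 * c\<^sup>2 * \<kappa>\<^sup>2 < 1"
    and F: "(\<Sum>j\<in>UNIV. (norm (column j C))\<^sup>2) \<le> F"
  shows "rad_mean (\<lambda>v. exp (c * (v \<bullet> (C *v v) - trace C))) \<le> exp (8 * c\<^sup>2 * F / (1 - 64 * c\<^sup>2 * \<kappa>\<^sup>2))"
  using order_trans[OF rad_mean_exp_chaos_le[of c C] rad_mean_exp_norm_sq_le[OF C \<open>0 \<le> \<kappa>\<close> _ _ F, of "8 * c\<^sup>2"]] r
  by simp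

lemma norm_sq_vec: "(norm (u :: real ^ 'n))\<^sup>2 = (\<Sum>i\<in>UNIV. (u $ i)\<^sup>2)"
  unfolding power2_norm_eq_inner by (simp add: inner_vec_def power2_eq_square)

lemma norm_sign_mult: "v \<in> sign_vectors \<Longrightarrow> norm (v * w) = norm w"
proof -
  assume v: "v \<in> sign_vectors"
  have "(v $ i * w $ i)\<^sup>2 = (w $ i)\<^sup>2" for i
    using sign_vectors_sq[OF v, of i] by (simp add: power_mult_distrib power2_eq_square)
  then have "(norm (v * w))\<^sup>2 = (norm w)\<^sup>2" by (simp add: norm_sq_vec)
  then show ?thesis by simp
qed

lemma inner_times_swap: "(x * y) \<bullet> (z :: real ^ 'n) = y \<bullet> (x * z)"
  by (simp add: inner_vec_def mult_ac)

subsection \<open>Block decomposition\<close>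

text \<open>Polarization: for unit vectors with disjoint supports, \<open>a + b\<close> and
  \<open>a - b\<close> are \<open>k\<close>-sparse of squared norm 2, so four times the inner
  product of the images is at most \<open>4 * \<delta>\<close>. Using \<open>- b\<close> as well
  gives the absolute value, and scaling gives the general case.\<close>

lemma restricted_isometry_inner_le:
  fixes \<Phi> :: "real ^ 'n ^ 'm"
  assumes rip: "restricted_isometry \<Phi> k \<delta>"
    and u: "\<And>j. j \<notin> S \<Longrightarrow> u $ j = 0" and v: "\<And>j. j \<notin> T \<Longrightarrow> v $ j = 0"
    and disj: "S \<inter> T = {}" and card: "card (S \<union> T) \<le> k"
  shows "\<bar>(\<Phi> *v u) \<bullet> (\<Phi> *v v)\<bar> \<le> \<delta> * norm u * norm v"
proof -
  have orth: "a \<bullet> b = 0" if "\<And>j. j \<notin> S \<Longrightarrow> a $ j = 0" "\<And>j. j \<notin> T \<Longrightarrow> b $ j = 0" for a b :: "real ^ 'n"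
  proof -
    have "a $ j * b $ j = 0" for j using that[of j] disj by auto
    then show ?thesis unfolding inner_vec_def by (intro sum.neutral) auto
  qed
  have key: "(\<Phi> *v a) \<bullet> (\<Phi> *v b) \<le> \<delta>"
    if a: "\<And>j. j \<notin> S \<Longrightarrow> a $ j = 0" and b: "\<And>j. j \<notin> T \<Longrightarrow> b $ j = 0"
      and n: "norm a = 1" "norm b = 1" for a b :: "real ^ 'n"
  proof -
    have sp: "sparse k w" if "\<And>j. j \<notin> S \<union> T \<Longrightarrow> w $ j = 0" for w :: "real ^ 'n"
    proof -
      have "{j. \<bar>w $ j\<bar> > 0} \<subseteq> S \<union> T" using that by auto
      then show ?thesis unfolding sparse_def using card by (meson card_mono finite order_trans)
    qed
    have "sparse k (a + b)" "sparse k (a - b)" by (rule sp, simp add: a b)+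
    then have *: "(norm (\<Phi> *v (a + b)))\<^sup>2 \<le> (1 + \<delta>) * (norm (a + b))\<^sup>2"
         "(1 - \<delta>) * (norm (a - b))\<^sup>2 \<le> (norm (\<Phi> *v (a - b)))\<^sup>2"
      using rip unfolding restricted_isometry_def by blast+
    have ab: "(norm (a + b))\<^sup>2 = 2" "(norm (a - b))\<^sup>2 = 2"
      using n orth[OF a b] by (auto simp: power2_norm_eq_inner algebra_simps inner_commute norm_eq_1)
    have "4 * ((\<Phi> *v a) \<bullet> (\<Phi> *v b)) = (norm (\<Phi> *v (a + b)))\<^sup>2 - (norm (\<Phi> *v (a - b)))\<^sup>2"
      by (simp add: matrix_vector_right_distrib matrix_vector_mult_diff_distrib power2_norm_eq_inner
          inner_add_left inner_add_right inner_diff_left inner_diff_right inner_commute)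
    also have "\<dots> \<le> (1 + \<delta>) * 2 - (1 - \<delta>) * 2"
      using * unfolding ab by (rule diff_mono)
    finally show ?thesis by (simp add: algebra_simps)
  qed
  show ?thesis
  proof (cases "u = 0 \<or> v = 0")
    case False
    define a b where "a = u /\<^sub>R norm u" and "b = v /\<^sub>R norm v"
    have n: "norm a = 1" "norm b = 1" "norm (- b) = 1" using False by (auto simp: a_def b_def)
    have supp: "\<And>j. j \<notin> S \<Longrightarrow> a $ j = 0" "\<And>j. j \<notin> T \<Longrightarrow> b $ j = 0" "\<And>j. j \<notin> T \<Longrightarrow> (-b) $ j = 0"
      using u v by (auto simp: a_def b_def)
    have neg: "\<Phi> *v (- b) = - (\<Phi> *v b)"
      using matrix_vector_mult_diff_distrib[of \<Phi> 0 b] by simp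
    have "\<bar>(\<Phi> *v a) \<bullet> (\<Phi> *v b)\<bar> \<le> \<delta>"
      using key[OF supp(1,2) n(1,2)] key[OF supp(1,3) n(1,3)] unfolding neg by (simp add: abs_le_iff)
    moreover have "u = norm u *\<^sub>R a" "v = norm v *\<^sub>R b" using False by (auto simp: a_def b_def)
    then have "\<Phi> *v u = norm u *\<^sub>R (\<Phi> *v a)" "\<Phi> *v v = norm v *\<^sub>R (\<Phi> *v b)"
      by (metis matrix_vector_mult_scaleR)+
    then have "(\<Phi> *v u) \<bullet> (\<Phi> *v v) = norm u * norm v * ((\<Phi> *v a) \<bullet> (\<Phi> *v b))"
      by simp
    ultimately show ?thesis
      using mult_left_mono[of "\<bar>(\<Phi> *v a) \<bullet> (\<Phi> *v b)\<bar>" \<delta> "norm u * norm v"]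
      by (simp add: abs_mult mult_ac)
  qed auto
qed

text \<open>The sets \<open>{i. \<beta> i = L}\<close> are consecutive blocks of size \<open>s\<close> in a decreasing rearrangement of \<open>\<bar>x $ i\<bar>\<close>;
  block \<open>0\<close> holds the largest entries. The union of two blocks is small enough for the restricted
  isometry property.\<close>

locale rip_blocks =
  fixes \<Phi> :: "real ^ 'n ^ 'm" and k s K :: nat and \<delta> :: real
    and x :: "real ^ 'n" and \<beta> :: "'n \<Rightarrow> nat"
  assumes rip: "restricted_isometry \<Phi> k \<delta>" and \<delta>: "0 < \<delta>"
    and s: "0 < s" "2 * s \<le> k"
    and x: "norm x = 1"
    and \<beta>_le: "\<And>i. \<beta> i \<le> K"
    and card_block: "\<And>L. card {i. \<beta> i = L} \<le> s"
    and decay: "\<And>i L. \<beta> i = Suc L \<Longrightarrow> real s * (x $ i)\<^sup>2 \<le> (\<Sum>j | \<beta> j = L. (x $ j)\<^sup>2)"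
begin

definition blk :: "nat \<Rightarrow> real ^ 'n \<Rightarrow> real ^ 'n" where
  "blk L u = (\<chi> i. if \<beta> i = L then u $ i else 0)"

text \<open>A mixed norm of \<open>x * u\<close>: Euclidean within a block, summed over the blocks
  after the first. Bounds for pairs of blocks then add up to products of such norms.\<close>

definition tail_norm :: "real ^ 'n \<Rightarrow> real" where
  "tail_norm u = (\<Sum>L=1..K. norm (blk L (x * u)))"

lemma blk_add: "blk L (u + v) = blk L u + blk L v"
  by (simp add: blk_def vec_eq_iff)

lemma blk_scaleR: "blk L (c *\<^sub>R u) = c *\<^sub>R blk L u"
  by (simp add: blk_def vec_eq_iff)

lemma inner_blk: "blk L u \<bullet> w = u \<bullet> blk L w"
  unfolding blk_def inner_vec_def by (intro sum.cong) auto

lemma norm_sq_blk: "(norm (blk L u))\<^sup>2 = (\<Sum>i | \<beta> i = L. (u $ i)\<^sup>2)"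
proof -
  have "(norm (blk L u))\<^sup>2 = (\<Sum>i\<in>UNIV. if \<beta> i = L then (u $ i)\<^sup>2 else 0)"
    unfolding norm_sq_vec by (intro sum.cong) (auto simp: blk_def)
  then show ?thesis by (simp add: sum.If_cases)
qed

lemma sum_norm_sq_blk: "(\<Sum>L=0..K. (norm (blk L u))\<^sup>2) = (norm u)\<^sup>2"
proof -
  have "(\<Sum>L\<in>{0..K}. \<Sum>i | i \<in> UNIV \<and> \<beta> i = L. (u $ i)\<^sup>2) = (\<Sum>i\<in>UNIV. (u $ i)\<^sup>2)"
    using \<beta>_le by (intro sum.group) auto
  then show ?thesis unfolding norm_sq_blk by (simp add: norm_sq_vec)
qed

lemma sum_blk: "(\<Sum>L=0..K. blk L u) = u"
  using \<beta>_le by (simp add: vec_eq_iff blk_def)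

text \<open>Cauchy-Schwarz over the blocks. The shift by one matches \<open>decay\<close>, which
  controls a block of \<open>x\<close> by the one before it.\<close>

lemma sum_blk_product_le: "(\<Sum>L<K. norm (blk L u) * norm (blk (Suc L) w)) \<le> norm u * norm w"
proof -
  have "(\<Sum>L<K. norm (blk L u) * norm (blk (Suc L) w))
      \<le> L2_set (\<lambda>L. norm (blk L u)) {..<K} * L2_set (\<lambda>L. norm (blk (Suc L) w)) {..<K}"
    using L2_set_mult_ineq[of "\<lambda>L. norm (blk L u)" "\<lambda>L. norm (blk (Suc L) w)" "{..<K}"] by simp
  also have "\<dots> \<le> norm u * norm w"
  proof (intro mult_mono L2_set_nonneg norm_ge_zero)
    have "(\<Sum>L<K. (norm (blk L u))\<^sup>2) \<le> (\<Sum>L=0..K. (norm (blk L u))\<^sup>2)"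
      by (intro sum_mono2) auto
    then show "L2_set (\<lambda>L. norm (blk L u)) {..<K} \<le> norm u"
      unfolding L2_set_def sum_norm_sq_blk by (intro real_le_lsqrt sum_nonneg) auto
    have "(\<Sum>L<K. (norm (blk (Suc L) w))\<^sup>2) = (\<Sum>L\<in>Suc ` {..<K}. (norm (blk L w))\<^sup>2)"
      by (simp add: sum.reindex)
    also have "\<dots> \<le> (\<Sum>L=0..K. (norm (blk L w))\<^sup>2)"
      by (intro sum_mono2) auto
    finally show "L2_set (\<lambda>L. norm (blk (Suc L) w)) {..<K} \<le> norm w"
      unfolding L2_set_def sum_norm_sq_blk by (intro real_le_lsqrt sum_nonneg) auto
  qed
  finally show ?thesis .
qed

lemma tail_norm_nonneg: "0 \<le> tail_norm u"
  unfolding tail_norm_def by (intro sum_nonneg) auto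

text \<open>By \<open>decay\<close> each entry of \<open>x\<close> in block \<open>Suc L\<close> is
  at most \<open>norm (blk L x) / sqrt s\<close> in absolute value; the shifted Cauchy-Schwarz
  inequality with \<open>norm x = 1\<close> sums the blocks.\<close>

lemma tail_norm_le: "tail_norm u \<le> norm u / sqrt s"
proof -
  have "norm (blk (Suc L) (x * u)) \<le> norm (blk L x) * norm (blk (Suc L) u) / sqrt s" for L
  proof (rule power2_le_imp_le)
    have "(norm (blk (Suc L) (x * u)))\<^sup>2 = (\<Sum>i | \<beta> i = Suc L. (x $ i)\<^sup>2 * (u $ i)\<^sup>2)"
      by (simp add: norm_sq_blk power_mult_distrib)
    also have "\<dots> \<le> (\<Sum>i | \<beta> i = Suc L. ((norm (blk L x))\<^sup>2 / s) * (u $ i)\<^sup>2)"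
      using decay s by (intro sum_mono mult_right_mono) (auto simp: norm_sq_blk field_simps)
    also have "\<dots> = (norm (blk L x) * norm (blk (Suc L) u) / sqrt s)\<^sup>2"
      unfolding sum_distrib_left[symmetric] norm_sq_blk[of "Suc L", symmetric]
      by (simp add: power_divide power_mult_distrib)
    finally show "(norm (blk (Suc L) (x * u)))\<^sup>2 \<le> (norm (blk L x) * norm (blk (Suc L) u) / sqrt s)\<^sup>2" .
  qed auto
  then have "(\<Sum>L<K. norm (blk (Suc L) (x * u))) \<le> (\<Sum>L<K. norm (blk L x) * norm (blk (Suc L) u) / sqrt s)"
    by (rule sum_mono)
  also have "\<dots> \<le> norm u / sqrt s"
    using sum_blk_product_le[of x u] x
    by (simp add: sum_divide_distrib[symmetric] divide_right_mono)
  also have "(\<Sum>L<K. norm (blk (Suc L) (x * u))) = tail_norm u"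
    unfolding tail_norm_def
    by (rule sum.reindex_bij_witness[of _ "\<lambda>L. L - 1" Suc]) auto
  finally show ?thesis .
qed

text \<open>A coordinate vector meets a single block. The squares of the bounds
  \<open>\<bar>x $ j\<bar>\<close> sum to 1, which is what the Frobenius norm calls for.\<close>

lemma tail_norm_axis_le: "tail_norm (axis j 1) \<le> \<bar>x $ j\<bar>"
proof -
  have "blk L (x * axis j 1) = (if \<beta> j = L then axis j (x $ j) else 0)" for L
    by (auto simp: vec_eq_iff blk_def axis_def)
  moreover have "norm (axis j (x $ j)) = \<bar>x $ j\<bar>"
    by (simp add: norm_eq_sqrt_inner inner_axis_axis)
  ultimately have "tail_norm (axis j 1) = (\<Sum>L=1..K. if \<beta> j = L then \<bar>x $ j\<bar> else 0)"
    unfolding tail_norm_def by (intro sum.cong) auto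
  also have "\<dots> \<le> \<bar>x $ j\<bar>" by simp
  finally show ?thesis .
qed

lemma inner_blk_le:
  assumes "J \<noteq> L"
  shows "\<bar>(\<Phi> *v blk J u) \<bullet> (\<Phi> *v blk L w)\<bar> \<le> \<delta> * norm (blk J u) * norm (blk L w)"
proof (rule restricted_isometry_inner_le[OF rip, of "{i. \<beta> i = J}" _ "{i. \<beta> i = L}"])
  show "card ({i. \<beta> i = J} \<union> {i. \<beta> i = L}) \<le> k"
    using card_Un_le[of "{i. \<beta> i = J}" "{i. \<beta> i = L}"] card_block[of J] card_block[of L] s by linarith
qed (use assms in \<open>auto simp: blk_def\<close>)

lemma norm_sq_mult_blk:
  "(1 - \<delta>) * (norm (blk L u))\<^sup>2 \<le> (norm (\<Phi> *v blk L u))\<^sup>2"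
  "(norm (\<Phi> *v blk L u))\<^sup>2 \<le> (1 + \<delta>) * (norm (blk L u))\<^sup>2"
proof -
  have "{j. \<bar>blk L u $ j\<bar> > 0} \<subseteq> {i. \<beta> i = L}" by (auto simp: blk_def split: if_splits)
  then have "card {j. \<bar>blk L u $ j\<bar> > 0} \<le> card {i. \<beta> i = L}" by (intro card_mono) auto
  then have "sparse k (blk L u)" unfolding sparse_def using card_block[of L] s by linarith
  then show "(1 - \<delta>) * (norm (blk L u))\<^sup>2 \<le> (norm (\<Phi> *v blk L u))\<^sup>2"
  "(norm (\<Phi> *v blk L u))\<^sup>2 \<le> (1 + \<delta>) * (norm (blk L u))\<^sup>2"
    using rip unfolding restricted_isometry_def by blast+
qed

text \<open>The linear map representing \<open>tail_form\<close>; its matrix is the matrix of the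
  chaos.\<close>

definition tail_map :: "real ^ 'n \<Rightarrow> real ^ 'n" where
  "tail_map u = (\<Sum>J=1..K. \<Sum>L\<in>{1..K}-{J}. x * blk J (transpose \<Phi> *v (\<Phi> *v blk L (x * u))))"

definition tail_form :: "real ^ 'n \<Rightarrow> real ^ 'n \<Rightarrow> real" where
  "tail_form y u = (\<Sum>J=1..K. \<Sum>L\<in>{1..K}-{J}. (\<Phi> *v blk J (x * y)) \<bullet> (\<Phi> *v blk L (x * u)))"

text \<open>Each pair with block 0 is counted in one order only; symmetry supplies the factor 2 in
  \<open>norm_sq_decomp\<close>.\<close>

definition head_form :: "real ^ 'n \<Rightarrow> real ^ 'n \<Rightarrow> real" where
  "head_form y u = (\<Sum>L=1..K. (\<Phi> *v blk L (x * y)) \<bullet> (\<Phi> *v blk 0 (x * u)))"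

lemma inner_adjoint_blk: "(\<Phi> *v blk J (x * y)) \<bullet> w = y \<bullet> (x * blk J (transpose \<Phi> *v w))"
  by (metis inner_blk inner_commute inner_times_swap inner_transpose_mult)

lemma inner_tail_map: "y \<bullet> tail_map u = tail_form y u"
  by (simp add: tail_map_def tail_form_def inner_sum_right inner_adjoint_blk)

lemma linear_tail_map: "linear tail_map"
  by (rule linearI)
     (simp_all add: tail_map_def algebra_simps blk_add blk_scaleR matrix_vector_right_distrib
       matrix_vector_mult_scaleR sum.distrib scaleR_sum_right)

lemma tail_form_le: "\<bar>tail_form y u\<bar> \<le> \<delta> * tail_norm y * tail_norm u"
proof -
  have "\<bar>tail_form y u\<bar> \<le> (\<Sum>J=1..K. \<Sum>L\<in>{1..K}-{J}. \<delta> * norm (blk J (x * y)) * norm (blk L (x * u)))"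
    unfolding tail_form_def
    by (intro order_trans[OF sum_abs] sum_mono inner_blk_le) auto
  \<comment> \<open>Putting back the nonnegative terms with \<open>L = J\<close> lets the double sum
    factor.\<close>
  also have "\<dots> \<le> (\<Sum>J=1..K. \<Sum>L=1..K. \<delta> * norm (blk J (x * y)) * norm (blk L (x * u)))"
    using \<delta> by (intro sum_mono sum_mono2) auto
  also have "\<dots> = \<delta> * tail_norm y * tail_norm u"
    unfolding tail_norm_def mult.assoc sum_distrib_left[symmetric] sum_product ..
  finally show ?thesis .
qed

lemma head_form_le: "\<bar>head_form y u\<bar> \<le> \<delta> * tail_norm y * norm (blk 0 (x * u))"
proof -
  have "\<bar>head_form y u\<bar> \<le> (\<Sum>L=1..K. \<delta> * norm (blk L (x * y)) * norm (blk 0 (x * u)))"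
    unfolding head_form_def
    by (intro order_trans[OF sum_abs] sum_mono inner_blk_le) auto
  also have "\<dots> = \<delta> * tail_norm y * norm (blk 0 (x * u))"
    unfolding tail_norm_def mult.assoc sum_distrib_left[symmetric] sum_distrib_right[symmetric] ..
  finally show ?thesis .
qed

lemma tail_matrix: "matrix tail_map *v u = tail_map u"
  using linear_tail_map by (simp add: matrix_works linear_matrix_vector_mul_eq)

text \<open>Testing the form against \<open>tail_map u\<close> itself uses up one factor
  \<open>tail_norm\<close>. The other is kept: it becomes \<open>norm u / sqrt s\<close> for the
  operator norm and \<open>\<bar>x $ j\<bar>\<close> for the columns.\<close>

lemma norm_tail_map_le: "norm (tail_map u) \<le> \<delta> / sqrt s * tail_norm u"
proof -
  define w where "w = tail_map u"
  have "norm w * norm w = tail_form w u"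
    by (simp add: w_def inner_tail_map[symmetric] norm_eq_sqrt_inner)
  also have "\<dots> \<le> \<delta> * tail_norm w * tail_norm u" using tail_form_le[of w u] by linarith
  also have "\<dots> \<le> \<delta> * (norm w / sqrt s) * tail_norm u"
    using \<delta> by (intro mult_right_mono mult_left_mono tail_norm_le tail_norm_nonneg) auto
  finally have "norm w * norm w \<le> (\<delta> / sqrt s * tail_norm u) * norm w" by (simp add: mult_ac)
  then have "norm w \<le> \<delta> / sqrt s * tail_norm u"
    using \<delta> tail_norm_nonneg[of u] by - (rule le_if_sq_le_mult, auto)
  then show ?thesis by (simp add: w_def)
qed

lemma norm_tail_matrix_le: "norm (matrix tail_map *v u) \<le> \<delta> / s * norm u"
proof -
  have "norm (matrix tail_map *v u) \<le> \<delta> / sqrt s * (norm u / sqrt s)"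
    unfolding tail_matrix using \<delta> tail_norm_le
    by (intro order_trans[OF norm_tail_map_le] mult_left_mono) auto
  then show ?thesis by simp
qed

lemma frobenius_tail_matrix_le: "(\<Sum>j\<in>UNIV. (norm (column j (matrix tail_map)))\<^sup>2) \<le> \<delta>\<^sup>2 / s"
proof -
  have "(norm (column j (matrix tail_map)))\<^sup>2 \<le> \<delta>\<^sup>2 / s * (x $ j)\<^sup>2" for j
  proof -
    have "norm (column j (matrix tail_map)) \<le> \<delta> / sqrt s * \<bar>x $ j\<bar>"
      unfolding matrix_vector_mult_basis[symmetric] tail_matrix using \<delta> tail_norm_axis_le
      by (intro order_trans[OF norm_tail_map_le] mult_left_mono) auto
    then have "(norm (column j (matrix tail_map)))\<^sup>2 \<le> (\<delta> / sqrt s * \<bar>x $ j\<bar>)\<^sup>2"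
      by (intro power_mono) auto
    then show ?thesis by (simp add: power_mult_distrib power_divide)
  qed
  then have "(\<Sum>j\<in>UNIV. (norm (column j (matrix tail_map)))\<^sup>2) \<le> (\<Sum>j\<in>UNIV. \<delta>\<^sup>2 / s * (x $ j)\<^sup>2)"
    by (rule sum_mono)
  also have "\<dots> = \<delta>\<^sup>2 / s"
    unfolding sum_distrib_left[symmetric] norm_sq_vec[symmetric] using x by simp
  finally show ?thesis .
qed

text \<open>A coordinate lies in one block only, so of two distinct blocks at least one annihilates
  it. Hence the tail chaos is already centred.\<close>

lemma trace_tail_matrix: "trace (matrix tail_map) = 0"
proof -
  have "matrix tail_map $ i $ i = 0" for i
  proof -
    have "matrix tail_map $ i $ i = axis i 1 \<bullet> tail_map (axis i 1)"
      by (simp add: inner_axis' matrix_def)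
    also have "\<dots> = 0"
      unfolding inner_tail_map tail_form_def
    proof (intro sum.neutral ballI)
      fix J L assume "J \<in> {1..K}" "L \<in> {1..K} - {J}"
      moreover have "blk M (x * axis i 1) = 0" if "\<beta> i \<noteq> M" for M
        using that by (auto simp: vec_eq_iff blk_def axis_def)
      ultimately show "(\<Phi> *v blk J (x * axis i 1)) \<bullet> (\<Phi> *v blk L (x * axis i 1)) = 0"
        by (cases "\<beta> i = J") auto
    qed
    finally show ?thesis .
  qed
  then show ?thesis by (simp add: trace_def)
qed

lemma rad_mean_exp_tail_le:
  assumes "64 * c\<^sup>2 * (\<delta> / s)\<^sup>2 < 1"
  shows "rad_mean (\<lambda>v. exp (c * tail_form v v)) \<le> exp (8 * c\<^sup>2 * (\<delta>\<^sup>2 / s) / (1 - 64 * c\<^sup>2 * (\<delta> / s)\<^sup>2))"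
  using rad_mean_exp_chaos_tr0_le[OF norm_tail_matrix_le _ assms frobenius_tail_matrix_le] \<delta>
  by (simp add: trace_tail_matrix tail_matrix inner_tail_map)

lemma rad_mean_exp_head_le: "rad_mean (\<lambda>v. exp (c * head_form v v)) \<le> exp (c\<^sup>2 * \<delta>\<^sup>2 / (2 * s))"
proof -
  \<comment> \<open>Multiplying by \<open>fl e\<close> resamples the signs outside block 0 and keeps
    those inside. The head form is linear in the former, with coefficient vector
    \<open>w v\<close>.\<close>
  define fl :: "real ^ 'n \<Rightarrow> real ^ 'n" where "fl e = (\<chi> i. if \<beta> i = 0 then 1 else e $ i)" for e
  define w where "w v = v * (\<Sum>L=1..K. x * blk L (transpose \<Phi> *v (\<Phi> *v blk 0 (x * v))))" for v
  have fl: "fl e \<in> sign_vectors" if "e \<in> sign_vectors" for e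
    using that by (simp add: sign_vectors_def fl_def)
  have w: "e \<bullet> w v = head_form (v * e) v" for e v
    by (simp add: head_form_def w_def inner_adjoint_blk inner_times_swap inner_sum_right sum_distrib_left)
  have head_fl: "head_form (fl e * v) (fl e * v) = e \<bullet> w v" for e v
  proof -
    have "blk 0 (x * (fl e * v)) = blk 0 (x * v)" by (simp add: vec_eq_iff blk_def fl_def)
    moreover have "blk L (x * (fl e * v)) = blk L (x * (v * e))" if "L \<ge> 1" for L
      using that by (simp add: vec_eq_iff blk_def fl_def mult_ac)
    ultimately show ?thesis unfolding w head_form_def by (intro sum.cong) auto
  qed
  \<comment> \<open>Duality again: \<open>w v\<close> is tested against itself, and block 0
    contributes a norm of at most 1.\<close>
  have norm_w: "norm (w v) \<le> \<delta> / sqrt s" if v: "v \<in> sign_vectors" for v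
  proof -
    have "(norm (blk 0 (x * v)))\<^sup>2 \<le> (\<Sum>L=0..K. (norm (blk L (x * v)))\<^sup>2)"
      by (rule member_le_sum[where f = "\<lambda>L. (norm (blk L (x * v)))\<^sup>2"]) auto
    also have "\<dots> = 1" using norm_sign_mult[OF v, of x] x by (simp add: sum_norm_sq_blk mult.commute)
    finally have le1: "norm (blk 0 (x * v)) \<le> 1" using power2_le_imp_le[of "norm (blk 0 (x * v))" 1] by simp
    have "norm (w v) * norm (w v) = head_form (v * w v) v"
      by (simp add: w[symmetric] norm_eq_sqrt_inner)
    also have "\<dots> \<le> \<delta> * tail_norm (v * w v) * norm (blk 0 (x * v))"
      using head_form_le[of "v * w v" v] by linarith
    also have "\<dots> \<le> \<delta> * (norm (w v) / sqrt s) * 1"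
      using \<delta> le1 tail_norm_le[of "v * w v"] tail_norm_nonneg
      by (intro mult_mono mult_left_mono mult_nonneg_nonneg) (auto simp: norm_sign_mult[OF v])
    finally have "norm (w v) * norm (w v) \<le> (\<delta> / sqrt s) * norm (w v)" by (simp add: mult_ac)
    then show ?thesis
      using \<delta> by - (rule le_if_sq_le_mult, auto)
  qed
  have "rad_mean (\<lambda>v. exp (c * head_form v v)) = rad_mean (\<lambda>e. rad_mean (\<lambda>v. exp (c * head_form (fl e * v) (fl e * v))))"
    using rad_mean_cong[of "\<lambda>e. rad_mean (\<lambda>v. exp (c * head_form (fl e * v) (fl e * v)))"
        "\<lambda>_. rad_mean (\<lambda>v. exp (c * head_form v v))"]
    by (simp add: rad_mean_mult_sign[where f = "\<lambda>v. exp (c * head_form v v)"] fl)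
  also have "\<dots> = rad_mean (\<lambda>v. rad_mean (\<lambda>e. exp (e \<bullet> (c *\<^sub>R w v))))"
    unfolding head_fl by (subst rad_mean_swap) simp
  also have "\<dots> \<le> rad_mean (\<lambda>v. exp ((norm (c *\<^sub>R w v))\<^sup>2 / 2))"
    by (intro rad_mean_mono rad_mean_exp_inner_le)
  also have "\<dots> \<le> rad_mean (\<lambda>v::real^'n. exp (c\<^sup>2 * \<delta>\<^sup>2 / (2 * s)))"
  proof (rule rad_mean_mono)
    fix v :: "real ^ 'n" assume v: "v \<in> sign_vectors"
    have "(norm (w v))\<^sup>2 \<le> (\<delta> / sqrt s)\<^sup>2" using norm_w[OF v] by (intro power_mono) auto
    then have "c\<^sup>2 * (norm (w v))\<^sup>2 \<le> c\<^sup>2 * (\<delta>\<^sup>2 / s)" by (intro mult_left_mono) (auto simp: power_divide)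
    then show "exp ((norm (c *\<^sub>R w v))\<^sup>2 / 2) \<le> exp (c\<^sup>2 * \<delta>\<^sup>2 / (2 * s))"
      by (simp add: power_mult_distrib)
  qed
  finally show ?thesis by simp
qed

definition main_part :: "real ^ 'n \<Rightarrow> real" where
  "main_part v = (\<Sum>L=0..K. (norm (\<Phi> *v blk L (x * v)))\<^sup>2)"

lemma norm_sq_decomp:
  "(norm (\<Phi> *v (x * v)))\<^sup>2 = main_part v + (2 * head_form v v + tail_form v v)"
proof -
  define a where "a L = \<Phi> *v blk L (x * v)" for L
  define f where "f J L = a J \<bullet> a L" for J L
  have sym: "f J L = f L J" for J L by (simp add: f_def inner_commute)
  have K: "{0..K} = insert 0 {1..K}" by auto
  have "\<Phi> *v (x * v) = (\<Sum>L=0..K. a L)"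
    unfolding a_def by (subst (1) sum_blk[symmetric, of "x * v"])
      (rule linear_sum[OF matrix_vector_mul_linear])
  then have "(norm (\<Phi> *v (x * v)))\<^sup>2 = (\<Sum>J=0..K. \<Sum>L=0..K. f J L)"
    by (simp add: power2_norm_eq_inner inner_sum_left inner_sum_right f_def inner_commute)
  also have "\<dots> = f 0 0 + 2 * (\<Sum>L=1..K. f L 0) + (\<Sum>J=1..K. \<Sum>L=1..K. f J L)"
  proof -
    have "(\<Sum>L=1..K. f 0 L) = (\<Sum>L=1..K. f L 0)" by (intro sum.cong refl sym)
    then show ?thesis unfolding K by (simp add: sum.distrib)
  qed
  also have "(\<Sum>J=1..K. \<Sum>L=1..K. f J L) = (\<Sum>J=1..K. f J J) + (\<Sum>J=1..K. \<Sum>L\<in>{1..K}-{J}. f J L)"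
    unfolding sum.distrib[symmetric] by (intro sum.cong refl) (simp add: sum.remove)
  finally show ?thesis
    unfolding main_part_def head_form_def tail_form_def K
    by (simp add: a_def f_def power2_norm_eq_inner)
qed

text \<open>The isometry applies to each block separately, and sign changes preserve the total
  squared norm 1.\<close>

lemma main_part_bounds:
  assumes v: "v \<in> sign_vectors"
  shows "1 - \<delta> \<le> main_part v" "main_part v \<le> 1 + \<delta>"
proof -
  have *: "(\<Sum>L=0..K. (norm (blk L (x * v)))\<^sup>2) = 1"
    using norm_sign_mult[OF v, of x] x by (simp add: sum_norm_sq_blk mult.commute)
  have "(\<Sum>L=0..K. (1 - \<delta>) * (norm (blk L (x * v)))\<^sup>2) \<le> main_part v"
    unfolding main_part_def by (intro sum_mono norm_sq_mult_blk)
  then show "1 - \<delta> \<le> main_part v" by (simp add: sum_distrib_left[symmetric] *)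
  have "main_part v \<le> (\<Sum>L=0..K. (1 + \<delta>) * (norm (blk L (x * v)))\<^sup>2)"
    unfolding main_part_def by (intro sum_mono norm_sq_mult_blk)
  then show "main_part v \<le> 1 + \<delta>" by (simp add: sum_distrib_left[symmetric] *)
qed

section \<open>Tail bound for a unit vector\<close>

lemma rad_mean_exp_offdiag_le:
  fixes t :: real
  assumes t: "t\<^sup>2 = (3/100)\<^sup>2"
  shows "rad_mean (\<lambda>v. exp (t * s / \<delta> * (2 * head_form v v + tail_form v v))) \<le> exp (233/10000 * s)"
proof -
  \<comment> \<open>Any parameter \<open>t\<close> with \<open>3 * t - 4 * t\<^sup>2 - 16 * t\<^sup>2 / (1 - 256 * t\<^sup>2) > 1 / 20\<close> and some room for
    rounding \<open>k / 2\<close> would do.\<close>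
  define c where "c = t * s / \<delta>"
  \<comment> \<open>\<open>a\<close> and \<open>b\<close> are the exponents of the head bound at
    \<open>4 * c\<close> and of the tail bound at \<open>2 * c\<close>;
    \<open>7696 = 10000 - 2304\<close>, where \<open>2304/10000\<close> is
    \<open>256 * t\<^sup>2\<close>.\<close>
  define a where "a = 72/10000 * real s"
  define b where "b = 288/7696 * real s"
  have "c\<^sup>2 = 9/10000 * s\<^sup>2 / \<delta>\<^sup>2" unfolding c_def power_mult_distrib power_divide t by (simp add: power_divide)
  then have c2: "c\<^sup>2 * \<delta>\<^sup>2 = 9/10000 * s\<^sup>2" using \<delta> by simp
  have ha: "(4 * c)\<^sup>2 * \<delta>\<^sup>2 / (2 * s) = a"
  proof -
    have "(4 * c)\<^sup>2 * \<delta>\<^sup>2 = 16 * (c\<^sup>2 * \<delta>\<^sup>2)" by (simp add: power_mult_distrib)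
    also have "\<dots> = 144/10000 * s\<^sup>2" unfolding c2 by simp
    finally have e: "(4 * c)\<^sup>2 * \<delta>\<^sup>2 = 144/10000 * s\<^sup>2" .
    show ?thesis unfolding e using s by (simp add: a_def power2_eq_square)
  qed
  have h1: "64 * (2 * c)\<^sup>2 * (\<delta> / s)\<^sup>2 = 2304/10000"
  proof -
    have "64 * (2 * c)\<^sup>2 * (\<delta> / s)\<^sup>2 = 256 * (c\<^sup>2 * \<delta>\<^sup>2) / s\<^sup>2" by (simp add: power_mult_distrib power_divide)
    then show ?thesis unfolding c2 using s by simp
  qed
  have h2: "8 * (2 * c)\<^sup>2 * (\<delta>\<^sup>2 / s) = 288/10000 * s"
  proof -
    have "8 * (2 * c)\<^sup>2 * (\<delta>\<^sup>2 / s) = 32 * (c\<^sup>2 * \<delta>\<^sup>2) / s" by (simp add: power_mult_distrib)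
    then show ?thesis unfolding c2 using s by (simp add: power2_eq_square)
  qed
  have H: "rad_mean (\<lambda>v. exp (4 * c * head_form v v)) \<le> exp a"
    using rad_mean_exp_head_le[of "4 * c"] unfolding ha .
  have T: "rad_mean (\<lambda>v. exp (2 * c * tail_form v v)) \<le> exp b"
    using rad_mean_exp_tail_le[of "2 * c"] unfolding h1 h2 by (simp add: b_def)
  \<comment> \<open>Head and tail share signs, so they are separated by convexity at the price of
    doubling both coefficients. Shifting by \<open>a\<close> and \<open>b\<close> normalises the two
    exponentials before the midpoint inequality.\<close>
  have "rad_mean (\<lambda>v. exp (c * (2 * head_form v v + tail_form v v)))
     \<le> rad_mean (\<lambda>v. exp ((a + b) / 2) / 2 * (exp (- a) * exp (4 * c * head_form v v) + exp (- b) * exp (2 * c * tail_form v v)))"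
  proof (rule rad_mean_mono)
    fix v
    let ?p = "4 * c * head_form v v - a" and ?q = "2 * c * tail_form v v - b"
    have "exp (c * (2 * head_form v v + tail_form v v)) = exp ((a + b) / 2) * exp ((?p + ?q) / 2)"
      by (simp add: exp_add[symmetric] field_simps)
    also have "\<dots> \<le> exp ((a + b) / 2) * ((exp ?p + exp ?q) / 2)"
      by (intro mult_left_mono exp_midpoint_le) auto
    finally show "exp (c * (2 * head_form v v + tail_form v v))
      \<le> exp ((a + b) / 2) / 2 * (exp (- a) * exp (4 * c * head_form v v) + exp (- b) * exp (2 * c * tail_form v v))"
      by (simp add: exp_diff exp_minus field_simps)
  qed
  also have "\<dots> = exp ((a + b) / 2) / 2 * (exp (- a) * rad_mean (\<lambda>v. exp (4 * c * head_form v v))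
      + exp (- b) * rad_mean (\<lambda>v. exp (2 * c * tail_form v v)))"
    by (simp only: rad_mean_cmult rad_mean_add)
  also have "\<dots> \<le> exp ((a + b) / 2) / 2 * (exp (- a) * exp a + exp (- b) * exp b)"
    by (intro mult_left_mono add_mono H T) auto
  also have "\<dots> = exp ((a + b) / 2)" by (simp add: exp_minus)
  also have "\<dots> \<le> exp (233/10000 * s)" by (simp add: a_def b_def)
  finally show ?thesis by (simp add: c_def)
qed

lemma fraction_deviation_le:
  "rad_mean (\<lambda>v. if \<bar>(norm (\<Phi> *v (x * v)))\<^sup>2 - 1\<bar> > 4 * \<delta> then 1 else 0) \<le> 2 * exp (- (real s / 15))"
proof -
  define Y where "Y v = 2 * head_form v v + tail_form v v" for v
  define c where "c = 3/100 * s / \<delta>"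
  have c: "0 < c" using s \<delta> by (simp add: c_def)
  have c\<delta>: "c * (3 * \<delta>) = 9/100 * s" using \<delta> by (simp add: c_def)
  \<comment> \<open>Markov's inequality in pointwise form; the sum of the two exponentials covers
    both tails.\<close>
  have "rad_mean (\<lambda>v. if \<bar>(norm (\<Phi> *v (x * v)))\<^sup>2 - 1\<bar> > 4 * \<delta> then 1 else 0)
      \<le> rad_mean (\<lambda>v. exp (- (9/100 * s)) * (exp (c * Y v) + exp ((- c) * Y v)))"
  proof (rule rad_mean_mono)
    fix v :: "real ^ 'n" assume v: "v \<in> sign_vectors"
    have pos: "1 \<le> exp (- (9/100 * s)) * (exp (c * Y v) + exp ((- c) * Y v))"
      if "\<bar>(norm (\<Phi> *v (x * v)))\<^sup>2 - 1\<bar> > 4 * \<delta>"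
    proof -
      \<comment> \<open>The main part is within \<open>\<delta>\<close> of 1, so a deviation beyond
        \<open>4 * \<delta>\<close> leaves at least \<open>3 * \<delta>\<close> to the off-diagonal
        terms.\<close>
      have "\<bar>Y v\<bar> \<ge> 3 * \<delta>"
        using that main_part_bounds[OF v] norm_sq_decomp[of v] unfolding Y_def by linarith
      then have "c * \<bar>Y v\<bar> \<ge> 9/100 * s" using c unfolding c\<delta>[symmetric] by (intro mult_left_mono) auto
      then have "1 \<le> exp (- (9/100 * s) + c * \<bar>Y v\<bar>)" by simp
      also have "\<dots> = exp (- (9/100 * s)) * exp (c * \<bar>Y v\<bar>)" by (rule exp_add)
      also have "\<dots> \<le> exp (- (9/100 * s)) * (exp (c * Y v) + exp ((- c) * Y v))"
        by (intro mult_left_mono) (auto simp: abs_if)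
      finally show ?thesis .
    qed
    show "(if \<bar>(norm (\<Phi> *v (x * v)))\<^sup>2 - 1\<bar> > 4 * \<delta> then 1 else 0)
       \<le> exp (- (9/100 * s)) * (exp (c * Y v) + exp ((- c) * Y v))"
      using pos by (auto intro!: mult_nonneg_nonneg add_nonneg_nonneg)
  qed
  also have "\<dots> = exp (- (9/100 * s)) * (rad_mean (\<lambda>v. exp (c * Y v)) + rad_mean (\<lambda>v. exp ((- c) * Y v)))"
    by (simp only: rad_mean_cmult rad_mean_add)
  also have "\<dots> \<le> exp (- (9/100 * s)) * (exp (233/10000 * s) + exp (233/10000 * s))"
    using rad_mean_exp_offdiag_le[of "3/100"] rad_mean_exp_offdiag_le[of "- (3/100)"]
    by (intro mult_left_mono add_mono) (simp_all add: Y_def c_def)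
  \<comment> \<open>\<open>9/100 - 233/10000 = 667/10000\<close>, just above 1/15.\<close>
  also have "\<dots> = 2 * exp (- (667/10000 * s))"
    by (simp add: exp_add[symmetric])
  also have "\<dots> \<le> 2 * exp (- (real s / 15))" by simp
  finally show ?thesis .
qed

end

section \<open>Rearrangement into blocks\<close>

lemma obtain_decreasing_enumeration:
  fixes w :: "'n::finite \<Rightarrow> real"
  obtains h :: "'n \<Rightarrow> nat"
  where "bij_betw h UNIV {..<CARD('n)}" "\<And>i j. h i \<le> h j \<Longrightarrow> w j \<le> w i"
proof -
  obtain ys :: "'n list" where ys: "set ys = UNIV" "distinct ys"
    by (metis finite_distinct_list finite)
  \<comment> \<open>Sorting by \<open>- w\<close> puts the largest values first; \<open>h\<close>
    will be the position in this list.\<close>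
  define xs where "xs = sort_key (\<lambda>i. - w i) ys"
  have xs: "set xs = UNIV" "distinct xs" "length xs = CARD('n)"
    using ys distinct_card[of ys] by (auto simp: xs_def)
  define h where "h = inv_into {..<CARD('n)} ((!) xs)"
  have nth: "bij_betw ((!) xs) {..<CARD('n)} UNIV"
    using xs by (intro bij_betw_nth) auto
  have h: "bij_betw h UNIV {..<CARD('n)}" unfolding h_def using nth by (rule bij_betw_inv_into)
  have h_lt: "h i < length xs" for i
    using bij_betwE[OF h] xs(3) by auto
  have xs_h: "xs ! h i = i" for i
    unfolding h_def using nth by (intro f_inv_into_f) (auto simp: bij_betw_def)
  have "w j \<le> w i" if "h i \<le> h j" for i j
  proof -
    have "map (\<lambda>i. - w i) xs ! h i \<le> map (\<lambda>i. - w i) xs ! h j"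
      using that h_lt[of j] by (intro sorted_nth_mono) (auto simp: xs_def)
    then show ?thesis using h_lt by (simp add: xs_h)
  qed
  with h show ?thesis by (rule that)
qed

text \<open>The ranking is cut every \<open>s\<close> positions. A block with a nonempty successor
  is full, so it has \<open>s\<close> entries, each dominating every entry of the successor.\<close>

lemma obtain_decaying_blocks:
  fixes x :: "real ^ 'n"
  assumes s: "0 < s"
  obtains \<beta> :: "'n \<Rightarrow> nat" and K
  where "\<And>i. \<beta> i \<le> K" "\<And>L. card {i. \<beta> i = L} \<le> s"
    "\<And>i L. \<beta> i = Suc L \<Longrightarrow> real s * (x $ i)\<^sup>2 \<le> (\<Sum>j | \<beta> j = L. (x $ j)\<^sup>2)"
proof -
  obtain h where h: "bij_betw h (UNIV :: 'n set) {..<CARD('n)}"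
    and mono: "\<And>i j. h i \<le> h j \<Longrightarrow> \<bar>x $ j\<bar> \<le> \<bar>x $ i\<bar>"
    using obtain_decreasing_enumeration[of "\<lambda>i. \<bar>x $ i\<bar>"] by blast
  define \<beta> where "\<beta> i = h i div s" for i
  have inj: "inj_on h A" for A using h by (meson bij_betw_def inj_on_subset subset_UNIV)
  have image: "h ` {i. \<beta> i = L} \<subseteq> {L * s..<L * s + s}" for L
  proof safe
    fix i
    show "h i \<in> {\<beta> i * s..<\<beta> i * s + s}"
      using s div_mult_mod_eq[of "h i" s] mod_less_divisor[OF s, of "h i"]
      unfolding \<beta>_def atLeastLessThan_iff by linarith
  qed
  have card_le: "card {i. \<beta> i = L} \<le> s" for L
    using card_mono[OF _ image[of L]] by (simp add: card_image[OF inj])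
  show ?thesis
  proof (rule that[of \<beta> "CARD('n)"])
    show "\<beta> i \<le> CARD('n)" for i
    proof -
      have "h i < CARD('n)" using h by (auto simp: bij_betw_def)
      then show ?thesis unfolding \<beta>_def by (meson div_le_dividend less_imp_le order_trans)
    qed
    show "card {i. \<beta> i = L} \<le> s" for L by (rule card_le)
    fix i L assume i: "\<beta> i = Suc L"
    have hi: "L * s + s \<le> h i"
      using image[of "Suc L"] i by auto
    have "{L * s..<L * s + s} \<subseteq> h ` {j. \<beta> j = L}"
    proof
      fix n assume n: "n \<in> {L * s..<L * s + s}"
      have "h i < CARD('n)" using h by (auto simp: bij_betw_def)
      then have "n \<in> {..<CARD('n)}" using n hi by simp
      then obtain j where j: "n = h j" using h by (auto simp: bij_betw_def)
      have "n div s = L"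
        using n by (intro div_nat_eqI) (auto simp: mult.commute)
      then show "n \<in> h ` {j. \<beta> j = L}" using j by (auto simp: \<beta>_def)
    qed
    then have eq: "h ` {j. \<beta> j = L} = {L * s..<L * s + s}" using image by blast
    then have card: "card {j. \<beta> j = L} = s" using card_image[OF inj, of "{j. \<beta> j = L}"] by simp
    have "(\<Sum>j | \<beta> j = L. (x $ i)\<^sup>2) \<le> (\<Sum>j | \<beta> j = L. (x $ j)\<^sup>2)"
    proof (rule sum_mono)
      fix j assume "j \<in> {j. \<beta> j = L}"
      then have "h j \<in> {L * s..<L * s + s}" using eq by blast
      then have "\<bar>x $ i\<bar> \<le> \<bar>x $ j\<bar>" using hi by (intro mono) simp
      then show "(x $ i)\<^sup>2 \<le> (x $ j)\<^sup>2" by (rule abs_le_square_iff[THEN iffD1])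
    qed
    then show "real s * (x $ i)\<^sup>2 \<le> (\<Sum>j | \<beta> j = L. (x $ j)\<^sup>2)" by (simp add: card)
  qed
qed

subsection \<open>Probability of distortion\<close>

lemma diag_mat_mult: "diag_mat v *v x = v * x"
proof -
  have "(\<Sum>j\<in>UNIV. (if i = j then v $ i else 0) * x $ j) = v $ i * x $ i" for i
    by (simp add: if_distrib[of "\<lambda>z. z * _"] cong: if_cong)
  then show ?thesis by (simp add: vec_eq_iff diag_mat_def matrix_vector_mult_def)
qed

lemma rad_mean_distortion_le:
  fixes \<Phi> :: "real ^ 'n ^ 'm"
  assumes "restricted_isometry \<Phi> k \<delta>" "0 < \<delta>" "0 < s" "2 * s \<le> k"
  shows "rad_mean (\<lambda>v. if \<bar>(norm (\<Phi> *v (v * x)))\<^sup>2 - (norm x)\<^sup>2\<bar> > 4 * \<delta> * (norm x)\<^sup>2 then 1 else 0)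
       \<le> 2 * exp (- (real s / 15))"
proof (cases "x = 0")
  case False
  define y where "y = x /\<^sub>R norm x"
  have y: "norm y = 1" "x = norm x *\<^sub>R y" using False by (auto simp: y_def)
  obtain \<beta> :: "'n \<Rightarrow> nat" and K where \<beta>: "\<And>i. \<beta> i \<le> K" "\<And>L. card {i. \<beta> i = L} \<le> s"
    "\<And>i L. \<beta> i = Suc L \<Longrightarrow> real s * (y $ i)\<^sup>2 \<le> (\<Sum>j | \<beta> j = L. (y $ j)\<^sup>2)"
    using obtain_decaying_blocks[OF \<open>0 < s\<close>] by metis
  interpret rip_blocks \<Phi> k s K \<delta> y \<beta>
    by unfold_locales (fact assms y(1) \<beta>)+
  \<comment> \<open>Both sides scale with \<open>(norm x)\<^sup>2\<close>, so the event for
    \<open>x\<close> is the event for the unit vector \<open>y\<close>.\<close>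
  have "\<bar>(norm (\<Phi> *v (v * x)))\<^sup>2 - (norm x)\<^sup>2\<bar> > 4 * \<delta> * (norm x)\<^sup>2 \<longleftrightarrow>
        \<bar>(norm (\<Phi> *v (y * v)))\<^sup>2 - 1\<bar> > 4 * \<delta>" for v
  proof -
    have "v * x = norm x *\<^sub>R (y * v)" by (subst y(2)) (simp add: vec_eq_iff)
    then have "(norm (\<Phi> *v (v * x)))\<^sup>2 = (norm x)\<^sup>2 * (norm (\<Phi> *v (y * v)))\<^sup>2"
      by (simp add: matrix_vector_mult_scaleR power_mult_distrib)
    then have "(norm (\<Phi> *v (v * x)))\<^sup>2 - (norm x)\<^sup>2 = (norm x)\<^sup>2 * ((norm (\<Phi> *v (y * v)))\<^sup>2 - 1)"
      by (simp add: algebra_simps)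
    then have "\<bar>(norm (\<Phi> *v (v * x)))\<^sup>2 - (norm x)\<^sup>2\<bar> = (norm x)\<^sup>2 * \<bar>(norm (\<Phi> *v (y * v)))\<^sup>2 - 1\<bar>"
      by (simp add: abs_mult)
    moreover have "4 * \<delta> * (norm x)\<^sup>2 = (norm x)\<^sup>2 * (4 * \<delta>)" by simp
    moreover have "0 < (norm x)\<^sup>2" using False by simp
    ultimately show ?thesis by (simp only: mult_less_cancel_left_pos)
  qed
  then show ?thesis using fraction_deviation_le by simp
qed simp

text \<open>Passes from \<open>M\<close> to the finite average. The laws are compared as Borel
  measures, whence the condition on \<open>S\<close>.\<close>

lemma measure_rademacher_sequence:
  fixes \<xi> :: "'a \<Rightarrow> real ^ 'n"
  assumes \<xi>: "rademacher_sequence M \<xi>" and S: "S \<in> sets borel"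
  shows "measure M {\<omega> \<in> space M. \<xi> \<omega> \<in> S} = rad_mean (indicator S)"
proof -
  let ?U = "uniform_count_measure (sign_vectors :: (real ^ 'n) set)"
  have eq: "{\<omega> \<in> space M. \<xi> \<omega> \<in> S} = \<xi> -` S \<inter> space M" by auto
  have "measure M {\<omega> \<in> space M. \<xi> \<omega> \<in> S} = measure (distr M borel \<xi>) S"
    using measure_distr[of \<xi> M borel S] \<xi> S unfolding rademacher_sequence_def eq by argo
  also have "\<dots> = measure (distr ?U borel (\<lambda>v. v)) S"
    using \<xi> by (simp add: rademacher_sequence_def)
  also have "\<dots> = measure ?U (S \<inter> sign_vectors)"
  proof -
    have "(\<lambda>v. v) \<in> borel_measurable ?U"
      by (auto simp: measurable_def sets_uniform_count_measure space_uniform_count_measure)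
    then show ?thesis using S by (simp add: measure_distr space_uniform_count_measure)
  qed
  also have "\<dots> = real (card (S \<inter> sign_vectors)) / real (card (sign_vectors :: (real ^ 'n) set))"
    by (intro measure_uniform_count_measure) auto
  also have "\<dots> = rad_mean (indicator S)"
  proof -
    have "(\<Sum>v\<in>sign_vectors. indicator S v) = (\<Sum>v\<in>sign_vectors. if v \<in> S then 1 else (0::real))"
      by (intro sum.cong) (auto simp: indicator_def)
    also have "\<dots> = real (card (S \<inter> sign_vectors))"
      by (simp add: sum.If_cases Int_commute)
    finally show ?thesis unfolding rad_mean_def by simp
  qed
  finally show ?thesis .
qed

text \<open>For fixed \<open>x\<close> the expression is continuous in \<open>v\<close>, so the set
  is an intersection of closed sets.\<close>

lemma borel_distortion_set:
  fixes \<Phi> :: "real ^ 'n ^ 'm"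
  shows "{v. \<forall>x\<in>E. a x \<le> (norm (\<Phi> *v (v * x)))\<^sup>2 \<and> (norm (\<Phi> *v (v * x)))\<^sup>2 \<le> b x} \<in> sets borel"
proof -
  have cont: "continuous_on UNIV (\<lambda>v. (norm (\<Phi> *v (v * x)))\<^sup>2)" for x
  proof -
    have "linear (\<lambda>v. v * x)" by (rule linearI) (simp_all add: vec_eq_iff algebra_simps)
    then have "linear ((*v) \<Phi> \<circ> (\<lambda>v. v * x))" by (rule linear_compose[OF _ matrix_vector_mul_linear])
    then have "continuous_on UNIV (\<lambda>v. \<Phi> *v (v * x))"
      by (simp add: linear_continuous_on linear_conv_bounded_linear o_def)
    then show ?thesis by (intro continuous_intros)
  qed
  have "closed (\<Inter>x\<in>E. {v. a x \<le> (norm (\<Phi> *v (v * x)))\<^sup>2} \<inter> {v. (norm (\<Phi> *v (v * x)))\<^sup>2 \<le> b x})"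
    by (intro closed_INT closed_Int ballI closed_Collect_le cont continuous_on_const)
  note borel_closed[OF this]
  also have "(\<Inter>x\<in>E. {v. a x \<le> (norm (\<Phi> *v (v * x)))\<^sup>2} \<inter> {v. (norm (\<Phi> *v (v * x)))\<^sup>2 \<le> b x})
    = {v. \<forall>x\<in>E. a x \<le> (norm (\<Phi> *v (v * x)))\<^sup>2 \<and> (norm (\<Phi> *v (v * x)))\<^sup>2 \<le> b x}" by auto
  finally show ?thesis .
qed

text \<open>The logarithm \<open>L\<close> is at least 1 because its argument is at least 4.
  Rounding \<open>k / 2\<close> down costs at most 1/2, and \<open>20 * L - 1/2\<close> still
  exceeds \<open>15 * L\<close>.\<close>

lemma exp_block_size_le:
  fixes \<eta> :: real
  assumes "0 < \<eta>" "\<eta> \<le> 1" "1 \<le> p" "real k \<ge> 40 * ln (4 * real p / \<eta>)"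
  shows "0 < k div 2" "exp (- (real (k div 2) / 15)) \<le> \<eta> / (4 * real p)"
proof -
  define L where "L = ln (4 * real p / \<eta>)"
  have "\<eta> \<le> real p" using assms by linarith
  then have "4 \<le> 4 * real p / \<eta>" using assms by (simp add: pos_le_divide_eq)
  moreover have "exp 1 \<le> (4::real)" using exp_le by linarith
  ultimately have "exp 1 \<le> 4 * real p / \<eta>" by linarith
  then have L: "1 \<le> L" unfolding L_def using assms by (subst ln_ge_iff) auto
  have "real k \<le> 2 * real (k div 2) + 1" by linarith
  then have s: "15 * L \<le> real (k div 2)" using assms(4) L unfolding L_def[symmetric] by linarith
  then have "0 < real (k div 2)" using L by linarith
  then show "0 < k div 2" by simp
  have "exp (- (real (k div 2) / 15)) \<le> exp (- L)" using s by simp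
  also have "\<dots> = \<eta> / (4 * real p)"
    using assms by (simp add: L_def exp_minus)
  finally show "exp (- (real (k div 2) / 15)) \<le> \<eta> / (4 * real p)" .
qed

theorem theorem3p1:
  fixes \<eta> \<epsilon> \<delta> :: real
    and E :: "(real ^ 'n) set"
    and p k :: nat
    and \<Phi> :: "real ^ 'n ^ 'm"
    and M :: "'a measure"
    and \<xi> :: "'a \<Rightarrow> real ^ 'n"
  assumes "\<eta> > 0"
    and "0 < \<epsilon>" and "\<epsilon> < 1"
    and "finite E" and "card E = p"
    and "k > 0" and "real k \<ge> 40 * ln (4 * real p / \<eta>)"
    and "0 < \<delta>" and "\<delta> < 1"
    and "restricted_isometry \<Phi> k \<delta>" and "\<delta> \<le> \<epsilon> / 4"
    and "prob_space M" and "rademacher_sequence M \<xi>"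
  shows "measure M {\<omega> \<in> space M. \<forall>x\<in>E.
            (1 - \<epsilon>) * (norm x)\<^sup>2 \<le> (norm (\<Phi> *v (diag_mat (\<xi> \<omega>) *v x)))\<^sup>2 \<and>
            (norm (\<Phi> *v (diag_mat (\<xi> \<omega>) *v x)))\<^sup>2 \<le> (1 + \<epsilon>) * (norm x)\<^sup>2}
         > 1 - \<eta>"
proof (cases "\<eta> \<le> 1")
  case False
  \<comment> \<open>The lower bound \<open>1 - \<eta>\<close> is negative here.\<close>
  then show ?thesis by (intro less_le_trans[OF _ measure_nonneg]) simp
next
  case True
  define S where "S = {v. \<forall>x\<in>E. (1 - \<epsilon>) * (norm x)\<^sup>2 \<le> (norm (\<Phi> *v (v * x)))\<^sup>2 \<and>
                            (norm (\<Phi> *v (v * x)))\<^sup>2 \<le> (1 + \<epsilon>) * (norm x)\<^sup>2}"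
  define bad where "bad x v = (if \<bar>(norm (\<Phi> *v (v * x)))\<^sup>2 - (norm x)\<^sup>2\<bar> > 4 * \<delta> * (norm x)\<^sup>2 then 1 else 0 :: real)"
    for x v :: "real ^ 'n"
  have bad_le: "rad_mean (bad x) \<le> \<eta> / (2 * real p)" if "x \<in> E" for x
  proof -
    have "1 \<le> p" using that assms(4,5) by (metis One_nat_def Suc_leI card_gt_0_iff empty_iff)
    note s = exp_block_size_le[OF assms(1) True this assms(7)]
    have "rad_mean (bad x) \<le> 2 * exp (- (real (k div 2) / 15))"
      unfolding bad_def using rad_mean_distortion_le[OF assms(10,8) s(1)] by simp
    also have "\<dots> \<le> 2 * (\<eta> / (4 * real p))" using s(2) by simp
    finally show ?thesis by simp
  qed
  \<comment> \<open>Union bound as a pointwise inequality: a sign vector outside \<open>S\<close> is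
    bad for some \<open>x\<close> in \<open>E\<close>.\<close>
  have "1 \<le> rad_mean (\<lambda>v. indicator S v + (\<Sum>x\<in>E. bad x v))"
  proof -
    have "rad_mean (\<lambda>_ :: real ^ 'n. 1) \<le> rad_mean (\<lambda>v. indicator S v + (\<Sum>x\<in>E. bad x v))"
    proof (rule rad_mean_mono)
      fix v :: "real ^ 'n"
      have nonneg: "0 \<le> bad x v" for x by (simp add: bad_def)
      show "1 \<le> indicator S v + (\<Sum>x\<in>E. bad x v)"
      proof (cases "v \<in> S")
        case True
        then show ?thesis using nonneg by (simp add: sum_nonneg)
      next
        case False
        then obtain x where x: "x \<in> E" and
          "\<not> ((1 - \<epsilon>) * (norm x)\<^sup>2 \<le> (norm (\<Phi> *v (v * x)))\<^sup>2 \<and> (norm (\<Phi> *v (v * x)))\<^sup>2 \<le> (1 + \<epsilon>) * (norm x)\<^sup>2)"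
          unfolding S_def by blast
        then have "\<epsilon> * (norm x)\<^sup>2 < \<bar>(norm (\<Phi> *v (v * x)))\<^sup>2 - (norm x)\<^sup>2\<bar>"
          by (simp add: algebra_simps not_le abs_if) linarith
        moreover have "4 * \<delta> * (norm x)\<^sup>2 \<le> \<epsilon> * (norm x)\<^sup>2"
          using assms(11) by (intro mult_right_mono) auto
        ultimately have "bad x v = 1" by (simp add: bad_def)
        moreover have "bad x v \<le> (\<Sum>x\<in>E. bad x v)"
          using x assms(4) nonneg by (intro member_le_sum) auto
        ultimately show ?thesis using False by simp
      qed
    qed
    then show ?thesis by simp
  qed
  also have "\<dots> = rad_mean (indicator S) + (\<Sum>x\<in>E. rad_mean (bad x))"
    by (simp add: rad_mean_add rad_mean_sum)
  also have "(\<Sum>x\<in>E. rad_mean (bad x)) \<le> (\<Sum>x\<in>E. \<eta> / (2 * real p))"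
    by (intro sum_mono bad_le)
  \<comment> \<open>The sum is \<open>\<eta> / 2\<close>, or 0 when \<open>E\<close> is empty; the
    factor 2 in \<open>bad_le\<close> makes the inequality strict.\<close>
  also have "\<dots> < \<eta>" using assms(1,5) by simp
  finally have "1 - \<eta> < rad_mean (indicator S)" by simp
  also have "\<dots> = measure M {\<omega> \<in> space M. \<xi> \<omega> \<in> S}"
    unfolding S_def by (rule measure_rademacher_sequence[OF assms(13) borel_distortion_set, symmetric])
  finally show ?thesis unfolding S_def by (simp add: diag_mat_mult)
qed

end
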